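(* Let $a>0$ and $\alpha\in\mathbb{F}_a$. Then $$\int_{\mathbb{P}}e^{it\varphi(I)}\,\mathscr{D}_\alpha(d\varphi)=\lim_{k\to+\infty}\frac{\Gamma(a)}{2\pi i}\,\mathrm{PV}\!\int_{\gamma-i\infty}^{\gamma+i\infty}\frac{e^w}{w^a}\exp\left\{-\int_{\mathbb{R}}\log\left(1-\frac{itx}{w}\right)\alpha^{(k)}(dx)\right\}dw$$ holds for every $t\in\mathbb{R}$ and every $\gamma>0$.
   Context: For $a>0$, $\mathbb{F}_a$ is the set of finite measures $\alpha$ on $(\mathbb{R},\mathscr{B}(\mathbb{R}))$ with $\alpha(\mathbb{R})=a$ and $\int_{\mathbb{R}}\log(1+|x|)\,\alpha(dx)<+\infty$. For $k\in\mathbb{N}$ (positive integers), $\alpha^{(k)}$ is the measure $$\alpha^{(k)}(\cdot)=\alpha((-\infty,-k])\,\delta_{-k}(\cdot)+\alpha(\cdot\cap(-k,k))+\alpha([k,+\infty))\,\delta_k(\cdot).$$ $\mathbb{P}$ is the space of probability measures on $(\mathbb{R},\mathscr{B}(\mathbb{R}))$, and $\mathscr{D}_\alpha$ is the law on $\mathbb{P}$ of the Dirichlet process with parameter $\alpha$: under $\mathscr{D}_\alpha$, for every finite measurable partition $C_1,\ldots,C_{n+1}$ of $\mathbb{R}$, $(\varphi(C_1),\ldots,\varphi(C_n))$ has the Dirichlet distribution with parameter $(\alpha(C_1),\ldots,\alpha(C_{n+1}))$ (components with $\alpha(C_i)=0$ being a.s. $0$). $\varphi(I)=\int_{\mathbb{R}}x\,\varphi(dx)$,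 which is $\mathscr{D}_\alpha$-a.s. well defined and finite for $\alpha\in\mathbb{F}_a$. $\log$ is the principal logarithm ($\arg\in(-\pi,\pi]$), $w^a$ the principal power, and $\mathrm{PV}\int_{\gamma-i\infty}^{\gamma+i\infty}$ means $\lim_{R\to+\infty}\int_{\gamma-iR}^{\gamma+iR}$. *)

theory Defs
  imports "HOL-Probability.Probability" "HOL-Complex_Analysis.Complex_Analysis"
begin

definition log_finite_measures :: "real \<Rightarrow> real measure set" where
  "log_finite_measures a =
     {\<alpha>. sets \<alpha> = sets borel \<and> emeasure \<alpha> UNIV = ennreal a \<and>
          integrable \<alpha> (\<lambda>x. ln (1 + \<bar>x\<bar>))}"

definition truncated_measure :: "nat \<Rightarrow> real measure \<Rightarrow> real measure" where
  "truncated_measure k \<alpha> = measure_of UNIV (sets borel)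
     (\<lambda>A. emeasure \<alpha> {..- real k} * indicator A (- real k)
        + emeasure \<alpha> (A \<inter> {- real k<..<real k})
        + emeasure \<alpha> {real k..} * indicator A (real k))"

lemma space_truncated_measure [simp]: "space (truncated_measure k \<alpha>) = UNIV"
  by (simp add: truncated_measure_def space_measure_of_conv)

lemma sets_truncated_measure [simp, measurable_cong]:
  "sets (truncated_measure k \<alpha>) = sets borel"
  unfolding truncated_measure_def
  using sets.sigma_sets_eq[of "borel :: real measure"] by (simp add: sets_measure_of)

(* The set function above is countably additive, so measure_of does not collapse to 0. *)
lemma emeasure_truncated_measure:
  assumes "sets \<alpha> = sets borel" and A: "A \<in> sets borel"
  shows "emeasure (truncated_measure k \<alpha>) A =
      emeasure \<alpha> {..- real k} * indicator A (- real k)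
    + emeasure \<alpha> (A \<inter> {- real k<..<real k})
    + emeasure \<alpha> {real k..} * indicator A (real k)"
proof (rule emeasure_measure_of[OF truncated_measure_def])
  show "sets borel \<subseteq> Pow (UNIV :: real set)" by simp
  show "A \<in> sets (truncated_measure k \<alpha>)" using A by simp
  let ?m = "\<lambda>A. emeasure \<alpha> {..- real k} * indicator A (- real k)
    + emeasure \<alpha> (A \<inter> {- real k<..<real k})
    + emeasure \<alpha> {real k..} * indicator A (real k)"
  show "positive (sets (truncated_measure k \<alpha>)) ?m"
    by (simp add: positive_def)
  show "countably_additive (sets (truncated_measure k \<alpha>)) ?m"
  proof (rule countably_additiveI)
    fix B :: "nat \<Rightarrow> real set"
    assume B: "range B \<subseteq> sets (truncated_measure k \<alpha>)" "disjoint_family B"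
    have ind: "(\<Sum>i. c * indicator (B i) x) = c * indicator (\<Union>i. B i) x"
      for c :: ennreal and x
      using suminf_indicator[OF B(2), of x] by (simp add: ennreal_suminf_cmult)
    have "(\<Sum>i. emeasure \<alpha> (B i \<inter> {- real k<..<real k}))
        = emeasure \<alpha> (\<Union>i. B i \<inter> {- real k<..<real k})"
      using B assms(1) by (intro suminf_emeasure) (auto simp: disjoint_family_on_def)
    then show "(\<Sum>i. ?m (B i)) = ?m (\<Union>i. B i)"
      by (simp only: suminf_add[OF summableI summableI, symmetric] ind UN_simps(4)[symmetric] Int_UN_distrib2)
  qed
qed

(* Density of the coordinates in I when the remaining coordinate j equals 1 minus their sum. *)
definition dirichlet_density ::
  "nat set \<Rightarrow> nat \<Rightarrow> (nat \<Rightarrow> real) \<Rightarrow> (nat \<Rightarrow> real) \<Rightarrow> real" where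
  "dirichlet_density I j p y =
     (if (\<forall>i\<in>I. 0 < y i) \<and> (\<Sum>i\<in>I. y i) < 1
      then Gamma (\<Sum>i\<in>insert j I. p i) / (\<Prod>i\<in>insert j I. Gamma (p i))
           * (\<Prod>i\<in>I. y i powr (p i - 1)) * (1 - (\<Sum>i\<in>I. y i)) powr (p j - 1)
      else 0)"

(* Law of the first n of the n + 1 components, indexed from 0, of a Dirichlet vector with
   parameter (p 0, ..., p n); the parameters are nonnegative and not all zero. Components with
   parameter 0 vanish, and the last component with positive parameter is 1 minus the sum of
   the others. If p i > 0 for all i <= n, then j = n and this is the usual density on the
   simplex. *)
definition dirichlet :: "nat \<Rightarrow> (nat \<Rightarrow> real) \<Rightarrow> (nat \<Rightarrow> real) measure" where
  "dirichlet n p =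
     (let j = Max {i. i \<le> n \<and> 0 < p i}; I = {i. i \<le> n \<and> 0 < p i} - {j}
      in distr (density (\<Pi>\<^sub>M i\<in>I. lborel) (\<lambda>y. ennreal (dirichlet_density I j p y)))
               (\<Pi>\<^sub>M i\<in>{..<n}. borel)
               (\<lambda>y. \<lambda>i\<in>{..<n}. if i \<in> I then y i
                               else if i = j then 1 - (\<Sum>l\<in>I. y l) else 0))"

(* D is the law of the Dirichlet process with parameter alpha. The space of probability measures
   on the line carries the sigma-algebra generated by the evaluations at Borel sets, which
   prob_algebra borel provides. *)
definition dirichlet_process_law :: "real measure \<Rightarrow> real measure measure \<Rightarrow> bool" where
  "dirichlet_process_law \<alpha> D \<longleftrightarrow>
     prob_space D \<and> sets D = sets (prob_algebra borel) \<and>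
     (\<forall>n (C :: nat \<Rightarrow> real set).
        (\<forall>i\<le>n. C i \<in> sets borel) \<and> disjoint_family_on C {..n} \<and> (\<Union>i\<le>n. C i) = UNIV \<longrightarrow>
        distr D (\<Pi>\<^sub>M i\<in>{..<n}. borel) (\<lambda>\<phi>. \<lambda>i\<in>{..<n}. measure \<phi> (C i))
          = dirichlet n (\<lambda>i. measure \<alpha> (C i)))"

definition has_pv_vertical_integral ::
  "(complex \<Rightarrow> complex) \<Rightarrow> complex \<Rightarrow> real \<Rightarrow> bool" where
  "has_pv_vertical_integral f I \<gamma> \<longleftrightarrow>
     (\<forall>R>0. f contour_integrable_on linepath (Complex \<gamma> (- R)) (Complex \<gamma> R)) \<and>
     ((\<lambda>R. contour_integral (linepath (Complex \<gamma> (- R)) (Complex \<gamma> R)) f) \<longlongrightarrow> I) at_top"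

end

theory Submission
  imports Defs
begin

text \<open>
Write $m_k$ for the mean under $\varphi$ of the identity truncated at levels $-k$ and $k$. The proof
shows that for each single $k$ the expression under the limit is the characteristic function
$E[e^{itm_k}]$ of this bounded random variable, and then lets $k$ tend to infinity.

The link between the law of $m_k$ and $\alpha$ is the Markov-Krein identity
$E[(c + d\,\varphi(f))^{-a}] = \exp(-\int Ln(c + d f)\,d\alpha)$ for bounded $f \ge 0$, Re $c > 0$ and
Re $d \ge 0$ (lemma \<open>markov_krein_bounded\<close>). If $f$ takes finitely many values, it is a statement
about a Dirichlet vector $P$: with $X$ an independent gamma variable of parameter $a$, the components
of $X P$ are independent gamma variables (lemma \<open>distr_gamma_dirichlet\<close>), and integrating
$e^{\langle 1-z, XP\rangle}$ first over $X$ gives $E[\langle z,P\rangle^{-a}]$, first over the independent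
components gives $\prod z_i^{-p_i}$. Bounded functions follow by discretising their values.

Applied to $w - it\xi_k$, where $\xi_k$ is the truncated identity, this turns the integrand into
$e^w E[(w - itm_k)^{-a}]$. Once the expectation is pulled out, the contour integral is the inverse
Laplace transform of a power, $\frac{1}{2\pi i} PV\int e^w (w-s)^{-a}\,dw = e^s/\Gamma(a)$ for $s = itm_k$. For
$a \le 1$ this converges only conditionally; one integration by parts replaces the exponent by
$a + 1$, which yields both the limit (lemma \<open>truncated_inversion_tendsto\<close>) and a bound uniform in
$R$ and in imaginary $s$ (lemma \<open>truncated_inversion_bounded\<close>), so that Fubini and dominated convergence justify
the exchange. For exponents above $1$ the value is pointwise Fourier inversion of the gamma density.

Finally $m_k$ tends to $\varphi(I)$ whenever $\varphi$ has a first absolute moment. That this holds almost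
surely is where the logarithmic moment of $\alpha$ enters: the Markov-Krein identity for
$1 + s\min(|x|,k)$ gives, as $k$ tends to infinity, a lower bound
$\exp(-\int\log(1+s|x|)\,d\alpha)$ for the probability of a finite moment, and this bound tends to $1$ as
$s$ tends to $0$ (lemma \<open>integrable_under_dirichlet_process\<close>).
\<close>

section \<open>The Laplace transform of the gamma density\<close>

definition gamma_density :: "real \<Rightarrow> real \<Rightarrow> real" where
  "gamma_density a x = (if 0 < x then x powr (a - 1) * exp (- x) / Gamma a else 0)"

lemma gamma_density_nonneg: "0 < a \<Longrightarrow> 0 \<le> gamma_density a x"
  by (simp add: gamma_density_def)

lemma gamma_density_measurable [measurable]: "gamma_density a \<in> borel_measurable borel"
  unfolding gamma_density_def[abs_def] by measurable

lemma nn_integral_gamma_density: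
  assumes "0 < a"
  shows "(\<integral>\<^sup>+x. ennreal (gamma_density a x) \<partial>lborel) = 1"
proof -
  have g: "Gamma a > 0" using assms by simp
  have "(\<integral>\<^sup>+x. ennreal (gamma_density a x) \<partial>lborel)
      = (\<integral>\<^sup>+x. ennreal (1 / Gamma a) * ennreal (indicator {0..} x * x powr (a - 1) / exp x)
            \<partial>lborel)"
    using g by (intro nn_integral_cong)
      (auto simp: gamma_density_def ennreal_mult[symmetric] exp_minus field_simps indicator_def)
  also have "\<dots> = ennreal (1 / Gamma a) * ennreal (Gamma a)"
    by (subst nn_integral_cmult) (auto simp: Gamma_conv_nn_integral_real[OF assms])
  also have "\<dots> = 1" using g by (simp add: ennreal_mult[symmetric])
  finally show ?thesis .
qed

lemma gamma_density_has_integral: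
  assumes "0 < a"
  shows "has_bochner_integral lborel (gamma_density a) 1"
  using assms nn_integral_gamma_density[OF assms]
  by (intro has_bochner_integral_nn_integral) (auto simp: gamma_density_nonneg)

lemma gamma_density_laplace_real:
  assumes "0 < a" "0 < r"
  shows "has_bochner_integral lborel (\<lambda>x. gamma_density a x * exp ((1 - r) * x)) (r powr (- a))"
proof -
  have "has_bochner_integral lborel (\<lambda>x. gamma_density a (0 + r * x)) (1 /\<^sub>R \<bar>r\<bar>)"
    using gamma_density_has_integral[OF assms(1)] lborel_has_bochner_integral_real_affine_iff[of r _ _ 0]
          assms by blast
  then have "has_bochner_integral lborel (\<lambda>x. r powr (1 - a) * gamma_density a (0 + r * x)) (r powr
        (1 - a) * (1 /\<^sub>R \<bar>r\<bar>))"
    by (rule has_bochner_integral_mult_right)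
  moreover have "r powr (1 - a) * gamma_density a (0 + r * x) = gamma_density a x * exp ((1 - r) * x)" for x
  proof (cases "0 < x")
    case True
    then have "r powr (1 - a) * (r * x) powr (a - 1) = x powr (a - 1)"
      using assms by (simp add: powr_mult powr_diff field_simps)
    moreover have "exp (- x) * exp ((1 - r) * x) = exp (- (r * x))"
      by (simp add: exp_add[symmetric] algebra_simps)
    ultimately show ?thesis using True assms by (simp add: gamma_density_def) (metis mult.assoc)
  next
    case False
    then show ?thesis using assms by (simp add: gamma_density_def zero_less_mult_iff)
  qed
  moreover have "r powr (1 - a) * (1 /\<^sub>R \<bar>r\<bar>) = r powr (- a)"
    using assms by (simp add: powr_diff powr_minus field_simps)
  ultimately show ?thesis by simp
qed

text \<open>Multiplying by $x^n$ turns the gamma density of parameter $a$ into a multiple of the one of parameter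
$a + n$.\<close>

lemma gamma_density_moment:
  assumes "0 < a" "0 < r"
  shows "has_bochner_integral lborel (\<lambda>x. gamma_density a x * exp ((1 - r) * x) * x ^ n)
           (pochhammer a n * r powr (- a) / r ^ n)"
proof -
  have "has_bochner_integral lborel (\<lambda>x. pochhammer a n * (gamma_density (a + real n) x * exp ((1 -
        r) * x)))
       (pochhammer a n * r powr (- (a + real n)))"
    using assms by (intro has_bochner_integral_mult_right gamma_density_laplace_real) auto
  moreover have "pochhammer a n * (gamma_density (a + real n) x * exp ((1 - r) * x))
      = gamma_density a x * exp ((1 - r) * x) * x ^ n" for x
  proof -
    have "pochhammer a n = Gamma (a + real n) / Gamma a"
      using assms by (intro pochhammer_Gamma) auto
    moreover have "Gamma (a + real n) > 0" "Gamma a > 0" using assms by auto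
    moreover have "x powr (a + real n - 1) = x powr (a - 1) * x ^ n" if "0 < x"
      using that by (simp add: powr_realpow[symmetric] powr_add[symmetric] algebra_simps)
    ultimately show ?thesis by (simp add: gamma_density_def)
  qed
  moreover have "pochhammer a n * r powr (- (a + real n)) = pochhammer a n * r powr (- a) / r ^ n"
    using assms by (simp add: powr_diff powr_realpow)
  ultimately show ?thesis by simp
qed

text \<open>The complex rate $z$ is reached from a real rate without analytic continuation. For $r$ large the
disc $|z - r| < r$ contains $z$; expanding $e^{(r-z)x}$ in powers of $x$ and integrating term by term
leaves $r^{-a}\sum_n \binom{-a}{n} ((z-r)/r)^n$, which the binomial series sums to $z^{-a}$.\<close>

lemma gamma_density_laplace:
  fixes z :: complex
  assumes a: "0 < a" and z: "0 < Re z"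
  shows "has_bochner_integral lborel (\<lambda>x. complex_of_real (gamma_density a x) * exp ((1 - z) *
        complex_of_real x))
           (z powr (- complex_of_real a))"
proof -
  \<comment> \<open>any \<open>r\<close> above \<open>cmod z ^ 2 / (2 * Re z)\<close> satisfies \<open>cmod
        (z - r) < r\<close>\<close>
  define r where "r = (cmod z)\<^sup>2 / (2 * Re z) + 1"
  have r: "0 < r" "(cmod z)\<^sup>2 < 2 * r * Re z" using z by (auto simp: r_def field_simps add_pos_nonneg)
  have "(cmod (z - of_real r))\<^sup>2 < r\<^sup>2"
    using r(2) unfolding cmod_power2 by (simp add: power2_eq_square algebra_simps)
  then have zr: "cmod (z - of_real r) < r"
    using r(1) by (meson less_le_not_le not_le power_mono norm_ge_zero order.strict_implies_order
          linorder_not_le power_less_imp_less_base)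
  define f :: "nat \<Rightarrow> real \<Rightarrow> complex" where "f
        = (\<lambda>n x. of_real (gamma_density a x * exp ((1 - r) * x) * x ^ n) * ((of_real r - z) ^ n /
        fact n))"
  have int_f: "has_bochner_integral lborel (f n) (of_real (pochhammer a n * r powr (- a) / r ^ n) *
        ((of_real r - z) ^ n / fact n))" for n
    unfolding f_def
    by (intro has_bochner_integral_mult_left has_bochner_integral_of_real gamma_density_moment a r(1))
  have norm_f: "has_bochner_integral lborel (\<lambda>x. norm (f n x)) (pochhammer a n * r powr (- a) / r ^
        n * (cmod (of_real r - z) ^ n / fact n))" for n
  proof -
    have "norm (f n x) = gamma_density a x * exp ((1 - r) * x) * x ^ n * (cmod (of_real r - z) ^ n / fact
          n)" for x
      by (cases "0 < x") (use a in \<open>auto simp: f_def norm_mult norm_divide norm_power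
            gamma_density_def\<close>)
    then show ?thesis
      by (simp only:) (rule has_bochner_integral_mult_left[OF gamma_density_moment[OF a r(1)]])
  qed
  define \<rho> where "\<rho> = cmod (of_real r - z) / r"
  have \<rho>: "0 \<le> \<rho>" "\<rho> < 1" using zr r by (auto simp: \<rho>_def norm_minus_commute)
  have summ: "summable (\<lambda>n. \<integral>x. norm (f n x) \<partial>lborel)"
  proof -
    have "(\<lambda>n. ((- complex_of_real a) gchoose n) * (- of_real \<rho>) ^ n) sums (1 + (- of_real
          \<rho>)) powr (- of_real a)"
      using \<rho> by (intro gen_binomial_complex) auto
    then have s: "summable (\<lambda>n. r powr (- a) * Re (((- complex_of_real a) gchoose n) * (- of_real
          \<rho>) ^ n))"
      by (intro summable_mult summable_Re sums_summable)
    have "r powr (- a) * Re (((- complex_of_real a) gchoose n) * (- of_real \<rho>) ^ n)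
          = (\<integral>x. norm (f n x) \<partial>lborel)" for n
    proof -
      have "((- complex_of_real a) gchoose n) * (- of_real \<rho>) ^ n
            = of_real (pochhammer a n / fact n * \<rho> ^ n)"
        by (simp add: gbinomial_pochhammer power_mult_distrib[symmetric] flip: pochhammer_of_real)
      then have "Re (((- complex_of_real a) gchoose n) * (- of_real \<rho>) ^ n)
            = pochhammer a n / fact n * \<rho> ^ n"
        by (simp only: Re_complex_of_real)
      then show ?thesis
        using has_bochner_integral_integral_eq[OF norm_f, of n]
        by (simp add: \<rho>_def power_divide field_simps)
    qed
    then show ?thesis using s by simp
  qed
  have f_alt: "f n x = of_real (gamma_density a x * exp ((1 - r) * x)) * (((of_real r - z) * of_real x) ^ n
        /\<^sub>R fact n)" for n x
    by (simp add: f_def power_mult_distrib scaleR_conv_of_real divide_inverse)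
  have ptw: "(\<lambda>n. f n x) sums (complex_of_real (gamma_density a x) * exp ((1 - z) * of_real x))" for x
  proof -
    have "(\<lambda>n. of_real (gamma_density a x * exp ((1 - r) * x)) * (((of_real r - z) * of_real x) ^ n
          /\<^sub>R fact n))
       sums (of_real (gamma_density a x * exp ((1 - r) * x)) * exp ((of_real r - z) * of_real x))"
      by (intro sums_mult exp_converges)
    moreover have "complex_of_real (exp ((1 - r) * x)) * exp ((of_real r - z) * of_real x)
          = exp ((1 - z) * of_real x)"
      by (simp add: exp_of_real[symmetric] exp_add[symmetric] algebra_simps)
    ultimately show ?thesis unfolding f_alt by (simp add: mult.assoc)
  qed
  have abs_ptw: "summable (\<lambda>n. norm (f n x))" for x
  proof -
    have "summable (\<lambda>n. norm (of_real (gamma_density a x * exp ((1 - r) * x)) * (((of_real r - z) *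
          of_real x) ^ n /\<^sub>R fact n)))"
      unfolding norm_mult by (intro summable_mult summable_norm_exp)
    then show ?thesis unfolding f_alt .
  qed
  have eq: "complex_of_real (gamma_density a x) * exp ((1 - z) * of_real x) = (\<Sum>n. f n x)" for x
    using ptw sums_unique by blast
  have int_f': "integrable lborel (f n)" for n
    using int_f unfolding has_bochner_integral_iff by blast
  have int: "integrable lborel (\<lambda>x. complex_of_real (gamma_density a x) * exp ((1 - z) * of_real x))"
    unfolding eq using int_f' abs_ptw summ by (intro integrable_suminf AE_I2)
  have "(\<lambda>n. integral\<^sup>L lborel (f n)) sums (\<integral>x. (\<Sum>n. f n x) \<partial>lborel)"
    using int_f' abs_ptw summ by (intro sums_integral AE_I2)
  moreover have "(\<lambda>n. integral\<^sup>L lborel (f n)) sums (z powr (- complex_of_real a))"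
  proof -
    define u where "u = (z - of_real r) / of_real r"
    have u: "norm u < 1" using zr r by (simp add: u_def norm_divide)
    have "(\<lambda>n. of_real (r powr (- a)) * (((- complex_of_real a) gchoose n) * u ^ n)) sums
            (of_real (r powr (- a)) * (1 + u) powr (- of_real a))"
      by (intro sums_mult gen_binomial_complex u)
    moreover have "of_real (r powr (- a)) * (((- complex_of_real a) gchoose n) * u ^ n)
          = integral\<^sup>L lborel (f n)" for n
    proof -
      have "u = - ((of_real r - z) / of_real r)" by (simp add: u_def minus_divide_left)
      then have "((- complex_of_real a) gchoose n) * u ^ n
            = of_real (pochhammer a n / fact n) * ((of_real r - z) / of_real r) ^ n"
        by (simp add: gbinomial_pochhammer power_minus[of "_ / _"] flip: pochhammer_of_real power_mult_distrib)
      then show ?thesis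
        using has_bochner_integral_integral_eq[OF int_f, of n] by (simp add: power_divide field_simps)
    qed
    moreover have "of_real (r powr (- a)) * (1 + u) powr (- of_real a) = z powr (- complex_of_real a)"
    proof -
      have "complex_of_real (r powr (- a)) = of_real r powr (- of_real a)"
        using r powr_of_real[of r "- a"] by simp
      moreover have "(of_real r * (1 + u)) powr (- of_real a)
            = of_real r powr (- of_real a) * (1 + u) powr (- complex_of_real a)"
        using r by (intro powr_times_real_left) auto
      moreover have "of_real r * (1 + u) = z" using r by (simp add: u_def field_simps)
      ultimately show ?thesis by simp
    qed
    ultimately show ?thesis by simp
  qed
  ultimately have "(\<integral>x. (\<Sum>n. f n x) \<partial>lborel) = z powr (- complex_of_real a)"
    by (rule sums_unique2)
  then show ?thesis using int by (simp add: has_bochner_integral_iff eq)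
qed

section \<open>Fourier inversion at a point of continuity\<close>

text \<open>The differentiation step in pointwise inversion: at a point of continuity the density is recovered
from the masses of shrinking intervals.\<close>

lemma density_average_tendsto:
  fixes g :: "real \<Rightarrow> real" and h :: "nat \<Rightarrow> real"
  assumes [measurable]: "g \<in> borel_measurable borel" and nonneg: "\<And>x. 0 \<le> g x"
    and fin: "finite_measure (density lborel (\<lambda>x. ennreal (g x)))"
    and cont: "isCont g x" and h: "\<And>n. 0 < h n" "h \<longlonglongrightarrow> 0"
  shows "(\<lambda>n. measure (density lborel (\<lambda>x. ennreal (g x))) {x<..x + h n} / h n)
        \<longlonglongrightarrow> g x"
proof (rule LIMSEQ_I)
  let ?M = "density lborel (\<lambda>x. ennreal (g x))"
  interpret M: finite_measure ?M by fact
  fix e :: real assume e: "0 < e"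
  obtain d where d: "0 < d" "\<And>y. \<bar>y - x\<bar> < d \<Longrightarrow> \<bar>g y - g x\<bar> < e / 2"
    using cont e unfolding isCont_def LIM_eq
          by (metis half_gt_zero abs_zero cancel_comm_monoid_add_class.diff_cancel real_norm_def)
  obtain N where N: "\<And>n. N \<le> n \<Longrightarrow> \<bar>h n\<bar> < d"
    using LIMSEQ_D[OF h(2) d(1)] by auto
  show "\<exists>no. \<forall>n\<ge>no. norm (measure ?M {x<..x + h n} / h n - g x) < e"
  proof (intro exI[of _ N] allI impI)
    fix n assume n: "N \<le> n"
    let ?I = "{x<..x + h n}"
    have close: "\<bar>g y - g x\<bar> < e / 2" if "y \<in> ?I" for y
      using that N[OF n] h(1)[of n] by (intro d(2)) auto
    have g_le: "g y \<le> g x + e / 2" "g x - e / 2 \<le> g y" if "y \<in> ?I" for y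
      using close[OF that] by linarith+
    have m: "ennreal (measure ?M ?I) = (\<integral>\<^sup>+y. ennreal (g y) * indicator ?I y \<partial>lborel)"
      by (simp add: M.emeasure_eq_measure[symmetric] emeasure_density)
    have "ennreal (measure ?M ?I) \<le> (\<integral>\<^sup>+y. ennreal (g x + e / 2) * indicator ?I y
          \<partial>lborel)"
      unfolding m using g_le
      by (intro nn_integral_mono) (simp split: split_indicator add: ennreal_leI)
    also have "\<dots> = ennreal ((g x + e / 2) * h n)"
      using h(1)[of n] nonneg[of x] e by (simp add: nn_integral_cmult_indicator ennreal_mult)
    finally have up: "measure ?M ?I \<le> (g x + e / 2) * h n"
      using h(1)[of n] nonneg[of x] e by (subst (asm) ennreal_le_iff) auto
    have "ennreal ((g x - e / 2) * h n) = ennreal (g x - e / 2) * ennreal (h n)"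
      using h(1)[of n] by (simp add: ennreal_mult'')
    also have "\<dots> = (\<integral>\<^sup>+y. ennreal (g x - e / 2) * indicator ?I y \<partial>lborel)"
      using h(1)[of n] by (simp add: nn_integral_cmult_indicator)
    also have "\<dots> \<le> ennreal (measure ?M ?I)"
      unfolding m using g_le
      by (intro nn_integral_mono) (simp split: split_indicator add: ennreal_leI)
    finally have lo: "(g x - e / 2) * h n \<le> measure ?M ?I"
      by (subst (asm) ennreal_le_iff) auto
    have "\<bar>measure ?M ?I / h n - g x\<bar> \<le> e / 2"
    proof -
      have "measure ?M ?I / h n \<le> g x + e / 2" "g x - e / 2 \<le> measure ?M ?I / h n"
        using up lo h(1)[of n] by (simp_all add: pos_divide_le_eq pos_le_divide_eq)
      then show ?thesis by linarith
    qed
    then show "norm (measure ?M ?I / h n - g x) < e" using e by simp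
  qed
qed

text \<open>Levy's formula expresses the mass of $(x, x+h]$ as an integral of the characteristic function
against the kernel \<open>K h\<close>. Divided by $h$, the mass tends to the density at $x$ and the kernel to
$e^{-itx}$; since \<open>cmod (K h t) \<le> h\<close>, integrability of the characteristic function dominates.\<close>

lemma density_fourier_inversion:
  fixes g :: "real \<Rightarrow> real"
  defines "M \<equiv> density lborel (\<lambda>x. ennreal (g x))"
  assumes g[measurable]: "g \<in> borel_measurable borel" and nonneg: "\<And>x. 0 \<le> g x"
    and prob: "prob_space M" and int: "integrable lborel (char M)" and cont: "isCont g x"
  shows "(CLINT t|lborel. iexp (- (t * x)) * char M t) = 2 * pi * g x"
proof -
  interpret M: prob_space M by fact
  interpret M: real_distribution M by standard (auto simp: M_def)
  note [measurable] = borel_measurable_integrable[OF int]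
  have pt: "measure M {u} = 0" for u
  proof -
    have "emeasure M {u} = (\<integral>\<^sup>+y. ennreal (g y) * indicator {u} y \<partial>lborel)"
      by (simp add: M_def emeasure_density)
    also have "\<dots> = 0"
      using AE_lborel_singleton[of u] by (subst nn_integral_0_iff_AE) (auto elim!: eventually_mono)
    finally show ?thesis by (simp add: measure_def)
  qed
  define K :: "real \<Rightarrow> real \<Rightarrow> complex"
    where "K = (\<lambda>h t. (iexp (- (t * x)) - iexp (- (t * (x + h)))) / (\<i> * t))"
  have K_m [measurable]: "K h \<in> borel_measurable borel" for h
    unfolding K_def by measurable
  have K_le: "cmod (K h t) \<le> h" if "0 \<le> h" for h t
  proof (cases "t = 0")
    case False
    then show ?thesis using Levy_Inversion_aux2[of "- (x + h)" "- x" t] that by (simp add: K_def algebra_simps)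
  qed (use that in \<open>simp add: K_def\<close>)
  have K_int: "integrable lborel (\<lambda>t. K h t * char M t)" if "0 \<le> h" for h
  proof (rule Bochner_Integration.integrable_bound)
    show "integrable lborel (\<lambda>t. h * cmod (char M t))" using int by auto
    show "AE t in lborel. norm (K h t * char M t) \<le> norm (h * cmod (char M t))"
      using K_le[OF that] that by (intro AE_I2) (auto simp: norm_mult intro!: mult_right_mono)
  qed measurable
  have lev: "(CLINT t|lborel. K h t * char M t) = 2 * pi * measure M {x<..x + h}" if h: "0 \<le> h" for h
  proof -
    have "(\<lambda>n. CLINT t|lborel. indicator {- real n<..<real n} t *\<^sub>R (K h t * char M t))
            \<longlonglongrightarrow> (CLINT t|lborel. K h t * char M t)"
    proof (rule integral_dominated_convergence[where w="\<lambda>t. cmod (K h t * char M t)"])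
      show "AE t in lborel. (\<lambda>n. indicator {- real n<..<real n} t *\<^sub>R (K h t * char M t))
            \<longlonglongrightarrow> K h t * char M t"
      proof (intro AE_I2 tendsto_eventually)
        fix t :: real
        obtain N :: nat where "\<bar>t\<bar> < real N" using reals_Archimedean2 by blast
        then show "\<forall>\<^sub>F n in sequentially. indicator {- real n<..<real n} t *\<^sub>R (K h t *
              char M t) = K h t * char M t"
          by (intro eventually_sequentiallyI[of N]) (auto simp: indicator_def)
      qed
    qed (use K_int[OF h] in \<open>auto simp: indicator_def\<close>)
    moreover have "(CLBINT t=- real n..real n. K h t * char M t)
        = (CLINT t|lborel. indicator {- real n<..<real n} t *\<^sub>R (K h t * char M t))" for n
      by (simp add: interval_lebesgue_integral_def set_lebesgue_integral_def einterval_eq)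
    moreover have "(\<lambda>n. complex_of_real (2 * pi) * (1 / (2 * pi) * (CLBINT t=- real n..real n. K h
          t * char M t)))
        \<longlonglongrightarrow> complex_of_real (2 * pi) * measure M {x<..x + h}"
      unfolding K_def using M.Levy_Inversion[of x "x + h"] pt h by (intro tendsto_mult_left) simp
    ultimately show ?thesis
      by (intro LIMSEQ_unique) (simp_all add: field_simps)
  qed
  define h :: "nat \<Rightarrow> real" where "h = (\<lambda>n. inverse (real (Suc n)))"
  have h: "0 < h n" for n by (simp add: h_def)
  have h0: "h \<longlonglongrightarrow> 0" unfolding h_def by (rule LIMSEQ_inverse_real_of_nat)
  have lim: "(\<lambda>n. CLINT t|lborel. K (h n) t / h n * char M t)
        \<longlonglongrightarrow> (CLINT t|lborel. iexp (- (t * x)) * char M t)"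
  proof (rule integral_dominated_convergence[where w="\<lambda>t. cmod (char M t)"])
    show "AE t in lborel. (\<lambda>n. K (h n) t / h n * char M t)
          \<longlonglongrightarrow> iexp (- (t * x)) * char M t"
      using AE_lborel_singleton[of "0::real"]
    proof eventually_elim
      case (elim t)
      have "((\<lambda>z. exp (- (\<i> * t * z))) has_field_derivative (exp (- (\<i> * t * x)) * (- (\<i> *
            t)))) (at (complex_of_real x))"
        by (auto intro!: derivative_eq_intros)
      then have "((\<lambda>z. (exp (- (\<i> * t * (complex_of_real x + z))) - exp (- (\<i> * t * x))) / z)
            \<longlongrightarrow> exp (- (\<i> * t * x)) * (- (\<i> * t))) (at 0)"
        unfolding DERIV_def .
      moreover have "filterlim (\<lambda>n. complex_of_real (h n)) (at 0) sequentially"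
      proof -
        have "(\<lambda>n. complex_of_real (h n)) \<longlonglongrightarrow> of_real 0"
              by (intro tendsto_of_real h0)
        moreover have "complex_of_real (h n) \<noteq> 0" for n using h[of n] by
              (simp add: less_imp_neq[symmetric])
        ultimately show ?thesis by (auto simp: filterlim_at)
      qed
      ultimately have "(\<lambda>n. (exp (- (\<i> * t * (complex_of_real x + h n))) - exp (- (\<i> * t *
            x))) / h n) \<longlonglongrightarrow> exp (- (\<i> * t * x)) * (- (\<i> * t))"
        by (rule filterlim_compose)
      then have "(\<lambda>n. (exp (- (\<i> * t * (complex_of_real x + h n))) - exp (- (\<i> * t * x))) / h
            n * (- (char M t / (\<i> * t))))
         \<longlonglongrightarrow> exp (- (\<i> * t * x)) * (- (\<i> * t)) * (- (char M t / (\<i> * t)))"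
        by (intro tendsto_mult_right)
      moreover have "(exp (- (\<i> * t * (complex_of_real x + h n))) - exp (- (\<i> * t * x))) / h n * (-
            (char M t / (\<i> * t))) = K (h n) t / h n * char M t" for n
      proof -
        have "(A - B) / h n * (- (c / (\<i> * t))) = (B - A) / (\<i> * t) / h n * c" for A B c :: complex
          using elim h[of n] by (simp add: field_simps)
        moreover have "exp (- (\<i> * t * (complex_of_real x + h n))) = iexp (- (t * (x + h n)))"
          by (simp add: algebra_simps)
        moreover have "exp (- (\<i> * t * x)) = iexp (- (t * x))"
          by (simp add: algebra_simps)
        ultimately show ?thesis by (simp only: K_def)
      qed
      ultimately show ?case using elim by (simp add: field_simps)
    qed
    show "AE t in lborel. cmod (K (h n) t / h n * char M t) \<le> cmod (char M t)" for n
    proof (rule AE_I2)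
      fix t
      have "cmod (K (h n) t) / h n \<le> 1" using K_le[of "h n" t] h[of n] by simp
      then have "cmod (K (h n) t) / h n * cmod (char M t) \<le> 1 * cmod (char M t)"
        by (intro mult_right_mono) auto
      then show "cmod (K (h n) t / h n * char M t) \<le> cmod (char M t)"
        using h[of n] by (simp add: norm_mult norm_divide)
    qed
  qed (use int in auto)
  have eq: "(CLINT t|lborel. K (h n) t / h n * char M t)
        = of_real (2 * pi * (measure M {x<..x + h n} / h n))" for n
  proof -
    have "(CLINT t|lborel. K (h n) t / h n * char M t) = (CLINT t|lborel. K (h n) t * char M t) / h n"
      by (subst integral_divide_zero[symmetric]) (simp add: field_simps)
    then show ?thesis using lev[of "h n"] h[of n] by simp
  qed
  have lim': "(\<lambda>n. complex_of_real (2 * pi * (measure M {x<..x + h n} / h n)))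
        \<longlonglongrightarrow> of_real (2 * pi * g x)"
    unfolding M_def using prob[unfolded M_def]
    by (intro tendsto_of_real tendsto_mult_left density_average_tendsto g nonneg cont h h0)
      (simp add: prob_space_def)
  show ?thesis by (rule LIMSEQ_unique[OF lim[unfolded eq] lim'])
qed

section \<open>Inverse Laplace transform of a complex power\<close>

lemma norm_powr_of_real_exponent:
  assumes "z \<noteq> 0"
  shows "cmod (z powr complex_of_real b) = cmod z powr b"
  using assms by (simp add: powr_def)

text \<open>The function $e^w (w - is)^{-b}$ on the line $w = \gamma + iy$, as a function of $y$.\<close>

definition shifted_exp_power :: "real \<Rightarrow> real \<Rightarrow> real \<Rightarrow> real
      \<Rightarrow> complex" where
  "shifted_exp_power \<gamma> b s y =
     exp (of_real \<gamma> + \<i> * of_real y) * (of_real \<gamma> + \<i> * of_real (y - s)) powr (- of_real b)"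

lemma continuous_on_shifted_exp_power [continuous_intros]:
  assumes "0 < \<gamma>"
  shows "continuous_on A (shifted_exp_power \<gamma> b s)"
proof -
  show ?thesis
    unfolding shifted_exp_power_def[abs_def] using assms
    by (auto intro!: continuous_intros simp: complex_eq_iff)
qed

lemma shifted_exp_power_measurable [measurable]:
  "0 < \<gamma> \<Longrightarrow> shifted_exp_power \<gamma> b s \<in> borel_measurable borel"
  by (intro borel_measurable_continuous_onI continuous_intros)

lemma norm_shifted_exp_power:
  assumes "0 < \<gamma>"
  shows "cmod (shifted_exp_power \<gamma> b s y)
        = exp \<gamma> * cmod (of_real \<gamma> + \<i> * of_real (y - s)) powr (- b)"
proof -
  have "complex_of_real \<gamma> + \<i> * of_real (y - s) \<noteq> 0"
    using assms by (auto simp: complex_eq_iff)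
  from norm_powr_of_real_exponent[OF this, of "- b"] show ?thesis
    by (simp add: shifted_exp_power_def norm_mult)
qed

text \<open>For exponents above $1$ the power decays integrably along a vertical line: its modulus is at most
$\gamma^{-b}$ near the real axis and at most $|y|^{-b}$ away from it.\<close>

lemma integrable_vertical_powr:
  assumes "0 < \<gamma>" "1 < b"
  shows "integrable lborel (\<lambda>y. cmod (complex_of_real \<gamma> + \<i> * of_real y) powr (- b))"
proof -
  define v where "v = (\<lambda>y. indicator {1..} y * y powr (- b))"
  define w where "w = (\<lambda>y. indicator {-1..1} y * \<gamma> powr (- b) + v y + v (- y))"
  have v_m[measurable]: "v \<in> borel_measurable borel" unfolding v_def by measurable
  have "((\<lambda>y. y powr (- b)) has_integral - (1 powr (- b + 1)) / (- b + 1)) {1..}"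
    using assms by (intro has_integral_powr_to_inf) auto
  then have "(\<integral>\<^sup>+y. ennreal (v y) \<partial>lborel)
        = ennreal (- (1 powr (- b + 1)) / (- b + 1))"
    unfolding v_def by (intro nn_integral_has_integral_lebesgue) auto
  then have v: "integrable lborel v"
    by (intro integrableI_nonneg) (auto simp: v_def)
  then have v': "integrable lborel (\<lambda>y. v (- y))"
    using lborel_integrable_real_affine_iff[of "-1" v 0] by simp
  have "integrable lborel w"
    unfolding w_def using v v'
    by (intro Bochner_Integration.integrable_add integrable_mult_left) auto
  then show ?thesis
  proof (rule Bochner_Integration.integrable_bound)
    show "AE y in lborel. norm (cmod (complex_of_real \<gamma> + \<i> * of_real y) powr (- b)) \<le> norm (w y)"
    proof (rule AE_I2)
      fix y :: real
      define q where "q = cmod (complex_of_real \<gamma> + \<i> * of_real y)"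
      have q: "\<gamma> \<le> q" "\<bar>y\<bar> \<le> q"
        using complex_Re_le_cmod[of "complex_of_real \<gamma> + \<i> * of_real y"]
          abs_Im_le_cmod[of "complex_of_real \<gamma> + \<i> * of_real y"] by (simp_all add: q_def)
      have nn: "0 \<le> v y" "0 \<le> v (- y)" by (auto simp: v_def)
      consider "-1 \<le> y \<and> y \<le> 1" | "1 < y" | "y < -1" by linarith
      then have "q powr (- b) \<le> w y"
      proof cases
        case 1
        have "q powr (- b) \<le> \<gamma> powr (- b)" using q assms by (intro powr_mono2') auto
        then show ?thesis using 1 nn by (simp add: w_def)
      next
        case 2
        have "q powr (- b) \<le> y powr (- b)" using q assms 2 by (intro powr_mono2') auto
        then show ?thesis using 2 nn by (simp add: w_def v_def)
      next
        case 3
        have "q powr (- b) \<le> (- y) powr (- b)" using q assms 3 by (intro powr_mono2') auto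
        then show ?thesis using 3 nn by (simp add: w_def v_def)
      qed
      then show "norm (cmod (complex_of_real \<gamma> + \<i> * of_real y) powr (- b)) \<le> norm (w y)"
        by (simp add: q_def)
    qed
  qed measurable
qed

lemma integrable_shifted_exp_power:
  assumes "0 < \<gamma>" "1 < b"
  shows "integrable lborel (shifted_exp_power \<gamma> b s)"
    and "(LINT y|lborel. cmod (shifted_exp_power \<gamma> b s y))
        = exp \<gamma> * (LINT y|lborel. cmod (complex_of_real \<gamma> + \<i> * of_real y) powr (- b))"
proof -
  have "integrable lborel (\<lambda>y. cmod (complex_of_real \<gamma> + \<i> * of_real (- s + 1 * y)) powr
        (- b))"
    using integrable_vertical_powr[OF assms] by (subst lborel_integrable_real_affine_iff) auto
  then have "integrable lborel (\<lambda>y. cmod (shifted_exp_power \<gamma> b s y))"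
    unfolding norm_shifted_exp_power[OF assms(1)] by (intro integrable_mult_right) (simp add: algebra_simps)
  then show "integrable lborel (shifted_exp_power \<gamma> b s)"
    by (rule integrable_norm_cancel) (use assms in measurable)
  show "(LINT y|lborel. cmod (shifted_exp_power \<gamma> b s y))
        = exp \<gamma> * (LINT y|lborel. cmod (complex_of_real \<gamma> + \<i> * of_real y) powr (- b))"
    unfolding norm_shifted_exp_power[OF assms(1)]
    using lborel_integral_real_affine[of 1 "\<lambda>y. cmod (complex_of_real \<gamma> + \<i> * of_real y)
          powr (- b)" "- s"]
    by (simp add: algebra_simps)
qed

text \<open>The gamma density of parameter $b$ has characteristic function $(1 - it)^{-b}$, which is integrable as
$b > 1$. Inverting it at the point $\gamma$ and substituting $t = -y/\gamma$ gives the value.\<close>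

lemma integral_shifted_exp_power_0:
  assumes \<gamma>: "0 < \<gamma>" and b: "1 < b"
  shows "(CLINT y|lborel. shifted_exp_power \<gamma> b 0 y) = 2 * pi / Gamma b"
proof -
  define M where "M = density lborel (\<lambda>x. ennreal (gamma_density b x))"
  have b0: "0 < b" using b by simp
  have char: "char M t = (1 - \<i> * t) powr (- of_real b)" for t :: real
  proof -
    have "char M t = (CLINT x|lborel. gamma_density b x *\<^sub>R iexp (t * x))"
      unfolding char_def M_def using gamma_density_nonneg[OF b0] by (intro integral_density) auto
    also have "\<dots> = (CLINT x|lborel. gamma_density b x * exp ((1 - (1 - \<i> * t)) * of_real x))"
      by (intro Bochner_Integration.integral_cong) (auto simp: scaleR_conv_of_real mult_ac)
    also have "\<dots> = (1 - \<i> * t) powr (- of_real b)"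
      using b0 by (intro has_bochner_integral_integral_eq gamma_density_laplace) auto
    finally show ?thesis .
  qed
  have "integrable lborel (\<lambda>t. cmod (of_real 1 + \<i> * of_real (0 + (-1) * t)) powr (- b))"
    using integrable_vertical_powr[of 1 b] b by (subst lborel_integrable_real_affine_iff) auto
  also have "(\<lambda>t. cmod (of_real 1 + \<i> * of_real (0 + (-1) * t)) powr (- b))
        = (\<lambda>t. cmod (char M t))"
  proof
    fix t :: real
    have "1 - \<i> * t \<noteq> 0" by (simp add: complex_eq_iff)
    from norm_powr_of_real_exponent[OF this, of "- b"]
    show "cmod (of_real 1 + \<i> * of_real (0 + (-1) * t)) powr (- b) = cmod (char M t)"
      by (simp add: char)
  qed
  finally have "integrable lborel (\<lambda>t. cmod (char M t))" .
  then have int: "integrable lborel (char M)"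
  proof (rule integrable_norm_cancel)
    have "1 - \<i> * complex_of_real t \<notin> \<real>\<^sub>\<le>\<^sub>0" for t by
          (simp add: complex_nonpos_Reals_iff)
    then have "continuous_on UNIV (char M)" unfolding char[abs_def] by (auto intro!: continuous_intros)
    then show "char M \<in> borel_measurable lborel" by (simp add: borel_measurable_continuous_onI)
  qed
  have cont: "isCont (gamma_density b) \<gamma>"
  proof -
    have "isCont (\<lambda>x. x powr (b - 1) * exp (- x) / Gamma b) \<gamma>"
      using \<gamma> Gamma_real_pos[OF b0] by (intro continuous_intros) auto
    moreover have "\<forall>\<^sub>F x in nhds \<gamma>. gamma_density b x
          = x powr (b - 1) * exp (- x) / Gamma b"
      using eventually_nhds_in_open[of "{0<..}" \<gamma>] \<gamma>
      by (auto simp: gamma_density_def elim!: eventually_mono)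
    ultimately show ?thesis by (simp add: isCont_cong)
  qed
  have prob: "prob_space M"
    using nn_integral_gamma_density[OF b0] by (intro prob_spaceI) (simp add: M_def emeasure_density)
  have "2 * pi * gamma_density b \<gamma> = (CLINT t|lborel. iexp (- (t * \<gamma>)) * char M t)"
    using density_fourier_inversion[of "gamma_density b" \<gamma>] gamma_density_nonneg[OF b0] prob int cont
    by (simp add: M_def)
  also have "\<dots> = \<bar>- 1 / \<gamma>\<bar> *\<^sub>R (CLINT y|lborel. iexp (- ((0 + (- 1 / \<gamma>)
        * y) * \<gamma>)) * char M (0 + (- 1 / \<gamma>) * y))"
    using \<gamma> by (intro lborel_integral_real_affine) auto
  also have "(\<lambda>y. iexp (- ((0 + (- 1 / \<gamma>) * y) * \<gamma>)) * char M (0 + (- 1 / \<gamma>) * y))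
      = (\<lambda>y. complex_of_real (exp (- \<gamma>) * \<gamma> powr b) * shifted_exp_power \<gamma> b 0 y)"
  proof
    fix y :: real
    have "1 - \<i> * complex_of_real (0 + (- 1 / \<gamma>) * y)
          = of_real (1 / \<gamma>) * (of_real \<gamma> + \<i> * y)"
      using \<gamma> by (simp add: field_simps)
    moreover have "(complex_of_real (1 / \<gamma>) * (of_real \<gamma> + \<i> * y)) powr (- of_real b)
        = complex_of_real (1 / \<gamma>) powr (- of_real b) * (of_real \<gamma> + \<i> * y) powr (- of_real b)"
      using \<gamma> by (intro powr_times_real_left) auto
    moreover have "complex_of_real (1 / \<gamma>) powr (- of_real b) = of_real (\<gamma> powr b)"
      using \<gamma> powr_of_real[of "1 / \<gamma>" "- b"] by (simp add: powr_divide powr_minus)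
    moreover have "iexp (- ((0 + (- 1 / \<gamma>) * y) * \<gamma>))
          = of_real (exp (- \<gamma>)) * exp (of_real \<gamma> + \<i> * y)"
      using \<gamma> by (simp add: exp_of_real[symmetric] exp_add[symmetric])
    ultimately show "iexp (- ((0 + (- 1 / \<gamma>) * y) * \<gamma>)) * char M (0 + (- 1 / \<gamma>) * y)
        = complex_of_real (exp (- \<gamma>) * \<gamma> powr b) * shifted_exp_power \<gamma> b 0 y"
      unfolding char by (simp add: shifted_exp_power_def)
  qed
  finally have "2 * pi * gamma_density b \<gamma>
        = (1 / \<gamma>) *\<^sub>R (complex_of_real (exp (- \<gamma>) * \<gamma> powr b) * (CLINT y|lborel.
        shifted_exp_power \<gamma> b 0 y))"
    using \<gamma> by simp
  moreover have "gamma_density b \<gamma> = exp (- \<gamma>) * \<gamma> powr b / (\<gamma> * Gamma b)"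
    using \<gamma> by (simp add: gamma_density_def powr_diff)
  ultimately show ?thesis
    using \<gamma> Gamma_real_pos[OF b0] by (simp add: scaleR_conv_of_real field_simps)
qed

lemma integral_shifted_exp_power:
  assumes \<gamma>: "0 < \<gamma>" and b: "1 < b"
  shows "(CLINT y|lborel. shifted_exp_power \<gamma> b s y) = 2 * pi * iexp s / complex_of_real (Gamma b)"
proof -
  have "(CLINT y|lborel. shifted_exp_power \<gamma> b s y)
        = \<bar>1\<bar> *\<^sub>R (CLINT y|lborel. shifted_exp_power \<gamma> b s (s + 1 * y))"
    by (rule lborel_integral_real_affine) simp
  also have "(\<lambda>y. shifted_exp_power \<gamma> b s (s + 1 * y))
        = (\<lambda>y. iexp s * shifted_exp_power \<gamma> b 0 y)"
    by (auto simp: shifted_exp_power_def exp_add algebra_simps)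
  finally show ?thesis using integral_shifted_exp_power_0[OF assms] by simp
qed

text \<open>This trades the exponent $a$, for which the integral over the whole line may fail to converge
absolutely, for $a + 1$, for which it does converge absolutely.\<close>

lemma shifted_exp_power_by_parts:
  assumes \<gamma>: "0 < \<gamma>" and R: "0 \<le> R"
  shows "(CLINT y|lborel. indicator {-R..R} y *\<^sub>R shifted_exp_power \<gamma> a s y)
     = - \<i> * (shifted_exp_power \<gamma> a s R - shifted_exp_power \<gamma> a s (- R))
       + a * (CLINT y|lborel. indicator {-R..R} y *\<^sub>R shifted_exp_power \<gamma> (a + 1) s y)"
proof -
  let ?h = "shifted_exp_power \<gamma> a s" and ?h' = "shifted_exp_power \<gamma> (a + 1) s"
  have ii: "integrable lborel (\<lambda>y. indicator {-R..R} y *\<^sub>R shifted_exp_power \<gamma> c s y)"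
        for c
    using borel_integrable_compact[of "{-R..R}" "shifted_exp_power \<gamma> c s"] \<gamma>
    by (auto intro!: continuous_intros)
  have deriv: "(?h has_vector_derivative \<i> * ?h y - \<i> * a * ?h' y) (at y within {-R..R})" for y
  proof -
    define z where "z = (\<lambda>w. complex_of_real \<gamma> + \<i> * (w - of_real s))"
    have nz: "z (of_real y) \<notin> \<real>\<^sub>\<le>\<^sub>0" for y
      using \<gamma> by (simp add: z_def complex_nonpos_Reals_iff)
    have dz: "(z has_field_derivative \<i>) (at w)" for w
      unfolding z_def by (auto intro!: derivative_eq_intros)
    have "((\<lambda>w. exp (of_real \<gamma> + \<i> * w) * z w powr (- of_real a)) has_field_derivative
       (exp (of_real \<gamma> + \<i> * y) * \<i> * z y powr (- of_real a)
         + (- of_real a * z y powr (- of_real a - 1) * \<i>) * exp (of_real \<gamma> + \<i> * y))) (at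
               (of_real y))"
      using nz by (auto intro!: derivative_eq_intros has_field_derivative_powr[THEN DERIV_chain2] dz)
    also have "- of_real a - 1 = - complex_of_real (a + 1)" by simp
    finally have "((\<lambda>y. exp (of_real \<gamma> + \<i> * of_real y) * z (of_real y) powr (- of_real
          a)) has_vector_derivative
       (exp (of_real \<gamma> + \<i> * y) * \<i> * z y powr (- of_real a)
         + (- of_real a * z y powr (- of_real (a + 1)) * \<i>) * exp (of_real \<gamma> + \<i> * y))) (at y
               within {-R..R})"
      by (rule has_vector_derivative_real_field)
    moreover have "exp (of_real \<gamma> + \<i> * y) * \<i> * z y powr (- of_real a)
         + (- of_real a * z y powr (- of_real (a + 1)) * \<i>) * exp (of_real \<gamma> + \<i> * y)
       = \<i> * ?h y - \<i> * a * ?h' y"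
      by (simp add: shifted_exp_power_def z_def algebra_simps del: of_real_add)
    moreover have "(\<lambda>y. exp (of_real \<gamma> + \<i> * of_real y) * z (of_real y) powr (- of_real
          a)) = ?h"
      by (simp add: shifted_exp_power_def[abs_def] z_def)
    ultimately show ?thesis by (simp only:)
  qed
  have "(CLINT y|lborel. indicator {-R..R} y *\<^sub>R (\<i> * ?h y - \<i> * a * ?h' y)) = ?h R - ?h (- R)"
    using R \<gamma> deriv by (intro integral_FTC_atLeastAtMost) (auto intro!: continuous_intros)
  also have "(CLINT y|lborel. indicator {-R..R} y *\<^sub>R (\<i> * ?h y - \<i> * a * ?h' y))
     = (CLINT y|lborel. \<i> * (indicator {-R..R} y *\<^sub>R ?h y) - \<i> * a * (indicator {-R..R} y
           *\<^sub>R ?h' y))"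
    by (intro Bochner_Integration.integral_cong) (auto simp: indicator_def)
  also have "\<dots> = \<i> * (CLINT y|lborel. indicator {-R..R} y *\<^sub>R ?h y) - \<i> * a * (CLINT
        y|lborel. indicator {-R..R} y *\<^sub>R ?h' y)"
    by (simp only: Bochner_Integration.integral_diff[OF integrable_mult_right[OF ii]
          integrable_mult_right[OF ii]]
        integral_mult_right_zero)
  finally have "\<i> * (CLINT y|lborel. indicator {-R..R} y *\<^sub>R ?h y)
        = ?h R - ?h (- R) + \<i> * a * (CLINT y|lborel. indicator {-R..R} y *\<^sub>R ?h' y)"
    by (simp add: algebra_simps)
  then have "- \<i> * (\<i> * (CLINT y|lborel. indicator {-R..R} y *\<^sub>R ?h y))
        = - \<i> * (?h R - ?h (- R) + \<i> * a * (CLINT y|lborel. indicator {-R..R} y *\<^sub>R ?h' y))"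
    by (rule arg_cong)
  then show ?thesis by (simp add: algebra_simps)
qed

text \<open>After integration by parts each boundary term has modulus at most $e^\gamma \gamma^{-a}$ and the
remaining integral is dominated by an absolutely convergent one, whose value does not depend on the
shift $s$.\<close>

lemma truncated_inversion_bounded:
  assumes \<gamma>: "0 < \<gamma>" and a: "0 < a"
  obtains C where "\<And>R s. 0 \<le> R
        \<Longrightarrow> cmod (CLINT y|lborel. indicator {-R..R} y *\<^sub>R shifted_exp_power \<gamma> a
        s y) \<le> C"
proof
  fix R s :: real assume R: "0 \<le> R"
  define L where "L = (LINT y|lborel. cmod (complex_of_real \<gamma> + \<i> * of_real y) powr (- (a + 1)))"
  have bd: "cmod (shifted_exp_power \<gamma> a s y) \<le> exp \<gamma> * \<gamma> powr (- a)" for y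
  proof -
    have "\<gamma> \<le> cmod (of_real \<gamma> + \<i> * of_real (y - s))"
      using complex_Re_le_cmod[of "complex_of_real \<gamma> + \<i> * of_real (y - s)"] by simp
    then show ?thesis unfolding norm_shifted_exp_power[OF \<gamma>]
      using \<gamma> a by (intro mult_left_mono powr_mono2') auto
  qed
  have "cmod (CLINT y|lborel. indicator {-R..R} y *\<^sub>R shifted_exp_power \<gamma> (a + 1) s y)
      \<le> (LINT y|lborel. norm (indicator {-R..R} y *\<^sub>R shifted_exp_power \<gamma> (a + 1) s y))"
    by (rule integral_norm_bound)
  also have "\<dots> \<le> (LINT y|lborel. cmod (shifted_exp_power \<gamma> (a + 1) s y))"
    using integrable_shifted_exp_power(1)[OF \<gamma>, of "a + 1" s] a
    by (intro integral_mono integrable_norm integrable_mult_indicator) (auto simp: indicator_def)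
  also have "\<dots> = exp \<gamma> * L"
    unfolding L_def using \<gamma> a by (intro integrable_shifted_exp_power) auto
  finally have i: "cmod (CLINT y|lborel. indicator {-R..R} y *\<^sub>R shifted_exp_power \<gamma> (a + 1) s
        y) \<le> exp \<gamma> * L" .
  have "cmod (CLINT y|lborel. indicator {-R..R} y *\<^sub>R shifted_exp_power \<gamma> a s y)
     \<le> cmod (- \<i> * (shifted_exp_power \<gamma> a s R - shifted_exp_power \<gamma> a s (- R)))
       + cmod (a * (CLINT y|lborel. indicator {-R..R} y *\<^sub>R shifted_exp_power \<gamma> (a + 1) s y))"
    by (subst shifted_exp_power_by_parts[OF \<gamma> R]) (rule norm_triangle_ineq)
  also have "\<dots> \<le> (exp \<gamma> * \<gamma> powr (- a) + exp \<gamma> * \<gamma> powr (- a)) + a *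
        (exp \<gamma> * L)"
    using norm_triangle_ineq4[of "shifted_exp_power \<gamma> a s R" "shifted_exp_power \<gamma> a s (- R)"]
          bd[of R] bd[of "- R"] i a
    unfolding norm_mult by (intro add_mono mult_mono) auto
  finally show "cmod (CLINT y|lborel. indicator {-R..R} y *\<^sub>R shifted_exp_power \<gamma> a s y)
      \<le> (exp \<gamma> * \<gamma> powr (- a) + exp \<gamma> * \<gamma> powr (- a))
         + a * (exp \<gamma> * (LINT y|lborel. cmod (complex_of_real \<gamma> + \<i> * of_real y) powr (-
               (a + 1))))"
    by (simp add: L_def)
qed

text \<open>The boundary terms vanish as $R$ grows, and $a \cdot 2\pi e^{is}/\Gamma(a+1) = 2\pi e^{is}/\Gamma(a)$.\<close>

lemma truncated_inversion_tendsto: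
  assumes \<gamma>: "0 < \<gamma>" and a: "0 < a"
  shows "((\<lambda>R. CLINT y|lborel. indicator {-R..R} y *\<^sub>R shifted_exp_power \<gamma> a s y)
        \<longlongrightarrow> 2 * pi * iexp s / complex_of_real (Gamma a)) at_top"
proof -
  let ?h = "shifted_exp_power \<gamma> a s" and ?h' = "shifted_exp_power \<gamma> (a + 1) s"
  have edge: "((\<lambda>R. ?h (f R)) \<longlongrightarrow> 0) at_top" if f: "filterlim (\<lambda>R.
        \<bar>f R - s\<bar>) at_top at_top" for f :: "real \<Rightarrow> real"
  proof (rule tendsto_norm_zero_cancel)
    have "filterlim (\<lambda>R. cmod (of_real \<gamma> + \<i> * of_real (f R - s))) at_top at_top"
      using f
    proof (rule filterlim_at_top_mono)
      show "\<forall>\<^sub>F R in at_top. \<bar>f R - s\<bar>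
            \<le> cmod (of_real \<gamma> + \<i> * of_real (f R - s))"
        using abs_Im_le_cmod[of "of_real \<gamma> + \<i> * of_real (f R - s)" for R]
              by (intro always_eventually) auto
    qed
    then have "((\<lambda>R. exp \<gamma> * cmod (of_real \<gamma> + \<i> * of_real (f R - s)) powr (- a))
          \<longlongrightarrow> exp \<gamma> * 0) at_top"
      using a by (intro tendsto_mult_left tendsto_neg_powr) auto
    then show "((\<lambda>R. norm (?h (f R))) \<longlongrightarrow> 0) at_top"
      by (simp add: norm_shifted_exp_power[OF \<gamma>])
  qed
  have abs: "filterlim (\<lambda>R::real. \<bar>R - s\<bar>) at_top at_top" "filterlim (\<lambda>R::real.
        \<bar>- R - s\<bar>) at_top at_top"
  proof -
    have "\<forall>\<^sub>F R in at_top. Z \<le> \<bar>R - s\<bar> \<and> Z \<le> \<bar>- R - s\<bar>" for Z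
      using eventually_ge_at_top[of "Z + \<bar>s\<bar>"] by eventually_elim linarith
    then show "filterlim (\<lambda>R::real. \<bar>R - s\<bar>) at_top at_top" "filterlim (\<lambda>R::real.
          \<bar>- R - s\<bar>) at_top at_top"
      unfolding filterlim_at_top by (simp_all add: eventually_conj_iff)
  qed
  have int: "integrable lborel ?h'" using \<gamma> a by (intro integrable_shifted_exp_power) auto
  have "((\<lambda>R. CLINT y|lborel. indicator {-R..R} y *\<^sub>R ?h' y) \<longlongrightarrow> (CLINT
        y|lborel. ?h' y)) at_top"
  proof (rule integral_dominated_convergence_at_top[where w="\<lambda>y. cmod (?h' y)"])
    show "AE y in lborel. ((\<lambda>R. indicator {-R..R} y *\<^sub>R ?h' y) \<longlongrightarrow> ?h' y)
          at_top"
    proof (intro AE_I2 tendsto_eventually)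
      fix y :: real
      show "\<forall>\<^sub>F R in at_top. indicator {-R..R} y *\<^sub>R ?h' y = ?h' y"
        using eventually_ge_at_top[of "\<bar>y\<bar>"] by eventually_elim (auto simp: indicator_def)
    qed
  qed (use int \<gamma> in \<open>auto simp: indicator_def\<close>)
  then have "((\<lambda>R. - \<i> * (?h R - ?h (- R)) + a * (CLINT y|lborel. indicator {-R..R} y *\<^sub>R
        ?h' y))
     \<longlongrightarrow> - \<i> * (0 - 0) + a * (CLINT y|lborel. ?h' y)) at_top"
    by (intro tendsto_intros edge abs)
  moreover have "\<forall>\<^sub>F R in at_top. - \<i> * (?h R - ?h (- R)) + a * (CLINT y|lborel. indicator
        {-R..R} y *\<^sub>R ?h' y)
     = (CLINT y|lborel. indicator {-R..R} y *\<^sub>R ?h y)"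
    using eventually_ge_at_top[of 0] by eventually_elim (rule shifted_exp_power_by_parts[OF \<gamma>,
          symmetric])
  moreover have "- \<i> * (0 - 0) + a * (CLINT y|lborel. ?h' y) = 2 * pi * iexp s / complex_of_real (Gamma a)"
  proof -
    have "(CLINT y|lborel. ?h' y) = 2 * pi * iexp s / complex_of_real (Gamma (a + 1))"
      using \<gamma> a by (intro integral_shifted_exp_power) auto
    moreover have "Gamma (a + 1) = a * Gamma a" using a by (intro Gamma_plus1) auto
    ultimately show ?thesis using a by simp
  qed
  ultimately show ?thesis using Lim_transform_eventually by force
qed

section \<open>Gamma variables and the Dirichlet distribution\<close>

interpretation lborel_product: product_sigma_finite "\<lambda>_. lborel :: real measure"
  by standard

text \<open>Scaling in each coordinate is the only change of variables in several dimensions that the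
gamma-Dirichlet relation requires; on boxes it reduces to the one-dimensional rule.\<close>

lemma nn_integral_PiM_lborel_scale:
  fixes F :: "('i \<Rightarrow> real) \<Rightarrow> ennreal"
  assumes I: "finite I" and x: "0 < x"
        and F[measurable]: "F \<in> borel_measurable (Pi\<^sub>M I (\<lambda>_. lborel))"
  shows "(\<integral>\<^sup>+y. F y \<partial>Pi\<^sub>M I (\<lambda>_. lborel))
        = ennreal (x ^ card I) * (\<integral>\<^sup>+y. F (\<lambda>i\<in>I. x * y i)
        \<partial>Pi\<^sub>M I (\<lambda>_. lborel))"
proof -
  let ?L = "Pi\<^sub>M I (\<lambda>_. lborel :: real measure)"
  let ?s = "\<lambda>y::'i \<Rightarrow> real. \<lambda>i\<in>I. x * y i"
  have s[measurable]: "?s \<in> ?L \<rightarrow>\<^sub>M ?L" by measurable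
  have one: "ennreal x * emeasure lborel ((\<lambda>t. x * t) -` A)
        = emeasure lborel A" if "A \<in> sets borel" for A :: "real set"
  proof -
    have "emeasure lborel A = (\<integral>\<^sup>+t. indicator A t \<partial>lborel)" using that by simp
    also have "\<dots> = ennreal \<bar>x\<bar> * (\<integral>\<^sup>+t. indicator A (0 + x * t)
          \<partial>lborel)"
      using x that by (intro nn_integral_real_affine) auto
    also have "(\<integral>\<^sup>+t. indicator A (0 + x * t) \<partial>lborel)
          = (\<integral>\<^sup>+t. indicator ((\<lambda>t. x * t) -` A) t \<partial>lborel)"
      by (intro nn_integral_cong) (auto simp: indicator_def)
    also have "\<dots> = emeasure lborel ((\<lambda>t. x * t) -` A)"
      using that measurable_sets[of "\<lambda>t. x * t" borel borel A] by (intro nn_integral_indicator) simp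
    finally show ?thesis using x by simp
  qed
  have "scale_measure (ennreal (x ^ card I)) (distr ?L ?L ?s) = ?L"
  proof (rule lborel_product.PiM_eqI[OF I])
    fix A :: "'i \<Rightarrow> real set" assume A: "\<And>i. i \<in> I \<Longrightarrow> A i \<in> sets lborel"
    have v: "(\<lambda>t. x * t) -` A i \<in> sets lborel" if "i \<in> I" for i
      using A[OF that] measurable_sets[of "\<lambda>t. x * t" borel borel "A i"] by simp
    have "?s -` (\<Pi>\<^sub>E i\<in>I. A i) \<inter> space ?L
          = (\<Pi>\<^sub>E i\<in>I. (\<lambda>t. x * t) -` A i)"
      by (auto simp: space_PiM PiE_iff extensional_def)
    moreover have "(\<Pi>\<^sub>E i\<in>I. A i) \<in> sets ?L" using A I by (intro sets_PiM_I_finite) auto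
    ultimately have "emeasure (scale_measure (ennreal (x ^ card I)) (distr ?L ?L ?s)) (\<Pi>\<^sub>E
          i\<in>I. A i)
        = ennreal (x ^ card I) * emeasure ?L (\<Pi>\<^sub>E i\<in>I. (\<lambda>t. x * t) -` A i)"
      by (simp add: emeasure_distr)
    also have "\<dots> = (\<Prod>i\<in>I. ennreal x) * (\<Prod>i\<in>I. emeasure lborel ((\<lambda>t. x *
          t) -` A i))"
      using v I x by (subst lborel_product.emeasure_PiM) (auto simp: ennreal_power)
    also have "\<dots> = (\<Prod>i\<in>I. emeasure lborel (A i))"
      unfolding prod.distrib[symmetric] using A one by (intro prod.cong) auto
    finally show "emeasure (scale_measure (ennreal (x ^ card I)) (distr ?L ?L ?s)) (\<Pi>\<^sub>E i\<in>I. A i)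
       = (\<Prod>i\<in>I. emeasure lborel (A i))" .
  qed simp
  then have "(\<integral>\<^sup>+y. F y \<partial>?L) = (\<integral>\<^sup>+y. F y
        \<partial>scale_measure (ennreal (x ^ card I)) (distr ?L ?L ?s))"
    by simp
  also have "\<dots> = ennreal (x ^ card I) * (\<integral>\<^sup>+y. F (?s y) \<partial>?L)"
    by (simp add: nn_integral_scale_measure nn_integral_distr)
  finally show ?thesis .
qed

text \<open>Homogeneity of the gamma densities: with total $x$ and proportions $y$, the powers of $x$ coming from
the densities and from the volume element \<open>x ^ card I\<close> combine to that of the gamma density of the
summed parameter, and the exponentials combine to $e^{-x}$.\<close>

lemma dirichlet_density_scaling:
  assumes I: "finite I" "j \<notin> I" and p: "\<And>i. i \<in> insert j I \<Longrightarrow> 0 < p i"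
        and x: "0 < x"
  shows "x ^ card I * ((\<Prod>i\<in>I. gamma_density (p i) (x * y i)) * gamma_density (p j) (x * (1 -
        (\<Sum>i\<in>I. y i))))
     = dirichlet_density I j p y * gamma_density (\<Sum>i\<in>insert j I. p i) x"
proof (cases "(\<forall>i\<in>I. 0 < y i) \<and> (\<Sum>i\<in>I. y i) < 1")
  case True
  let ?a = "\<Sum>i\<in>insert j I. p i" and ?u = "1 - (\<Sum>i\<in>I. y i)"
  have g: "Gamma ?a \<noteq> 0"
    using p I by (intro less_imp_neq[THEN not_sym] Gamma_real_pos sum_pos) auto
  have "(\<Prod>i\<in>I. gamma_density (p i) (x * y i))
      = (\<Prod>i\<in>I. x powr (p i - 1) * (y i powr (p i - 1)) * exp (- (x * y i)) / Gamma (p i))"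
    using True x by (intro prod.cong) (auto simp: gamma_density_def powr_mult)
  also have "\<dots> = (\<Prod>i\<in>I. x powr (p i - 1)) * (\<Prod>i\<in>I. y i powr (p i - 1)) *
        (\<Prod>i\<in>I. exp (- (x * y i))) / (\<Prod>i\<in>I. Gamma (p i))"
    by (simp add: prod.distrib prod_dividef)
  also have "(\<Prod>i\<in>I. x powr (p i - 1)) = x powr (\<Sum>i\<in>I. p i - 1)"
    using x I by (subst powr_sum) auto
  also have "(\<Prod>i\<in>I. exp (- (x * y i))) = exp (- (x * (\<Sum>i\<in>I. y i)))"
    using I by (simp add: exp_sum sum_distrib_left sum_negf flip: sum_negf)
  finally have P: "(\<Prod>i\<in>I. gamma_density (p i) (x * y i))
     = x powr (\<Sum>i\<in>I. p i - 1) * (\<Prod>i\<in>I. y i powr (p i - 1)) * exp (- (x * (\<Sum>i\<in>I.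
           y i))) / (\<Prod>i\<in>I. Gamma (p i))" .
  have J: "gamma_density (p j) (x * ?u) = x powr (p j - 1) * ?u powr (p j - 1) * exp (- (x * ?u)) / Gamma (p j)"
    using True x by (auto simp: gamma_density_def powr_mult)
  have xp: "x ^ card I * (x powr (\<Sum>i\<in>I. p i - 1) * x powr (p j - 1)) = x powr (?a - 1)"
    using x I by (simp add: powr_realpow[symmetric] powr_add[symmetric] sum_subtractf algebra_simps)
  have ex: "exp (- (x * (\<Sum>i\<in>I. y i))) * exp (- (x * ?u)) = exp (- x)"
    by (simp add: exp_add[symmetric] algebra_simps)
  have "x ^ card I * ((\<Prod>i\<in>I. gamma_density (p i) (x * y i)) * gamma_density (p j) (x * ?u))
     = (x ^ card I * (x powr (\<Sum>i\<in>I. p i - 1) * x powr (p j - 1))) * (exp (- (x * (\<Sum>i\<in>I. y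
           i))) * exp (- (x * ?u)))
       * ((\<Prod>i\<in>I. y i powr (p i - 1)) * ?u powr (p j - 1) / ((\<Prod>i\<in>I. Gamma (p i)) * Gamma
             (p j)))"
    unfolding P J by simp
  also have "\<dots> = dirichlet_density I j p y * gamma_density ?a x"
    unfolding xp ex using True x g I by (simp add: dirichlet_density_def gamma_density_def mult_ac)
  finally show ?thesis .
next
  case False
  have "(\<Prod>i\<in>I. gamma_density (p i) (x * y i)) * gamma_density (p j) (x * (1 - (\<Sum>i\<in>I. y
        i))) = 0"
  proof (cases "\<forall>i\<in>I. 0 < y i")
    case True
    then have "\<not> 0 < x * (1 - (\<Sum>i\<in>I. y i))" using False x by (simp add: zero_less_mult_iff)
    then show ?thesis by (simp add: gamma_density_def)
  next
    case False
    then obtain i where "i \<in> I" "\<not> 0 < y i" by auto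
    then have "gamma_density (p i) (x * y i) = 0" using x by (simp add: gamma_density_def zero_less_mult_iff)
    then show ?thesis using \<open>i \<in> I\<close> I by auto
  qed
  moreover have "dirichlet_density I j p y = 0" using False unfolding dirichlet_density_def by (rule if_not_P)
  ultimately show ?thesis by simp
qed

lemma dirichlet_density_measurable [measurable]:
  "finite I \<Longrightarrow> dirichlet_density I j p \<in> borel_measurable (Pi\<^sub>M I (\<lambda>_.
        lborel))"
  unfolding dirichlet_density_def[abs_def] by measurable

lemma dirichlet_density_nonneg:
  assumes "finite I" "\<And>i. i \<in> insert j I \<Longrightarrow> 0 < p i"
  shows "0 \<le> dirichlet_density I j p y"
  unfolding dirichlet_density_def using assms
  by (auto intro!: mult_nonneg_nonneg divide_nonneg_nonneg prod_nonneg less_imp_le[OF Gamma_real_pos] sum_pos)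

text \<open>Start from independent gamma coordinates $(y, u)$. Translating $u$ to the total $x = u + \sum y_i$ and
then, for fixed $x$, scaling $y$ by $x$ produces total and proportions; no multidimensional
Jacobian beyond the scaling factor appears because each step changes one group of variables while the others are fixed.\<close>

lemma nn_integral_gamma_dirichlet:
  assumes I: "finite I" "j \<notin> I" and p: "\<And>i. i \<in> insert j I \<Longrightarrow> 0 < p i"
    and F[measurable]: "F \<in> borel_measurable (Pi\<^sub>M (insert j I) (\<lambda>_. lborel))"
  shows "(\<integral>\<^sup>+v. ennreal (\<Prod>i\<in>insert j I. gamma_density (p i) (v i)) * F v
        \<partial>Pi\<^sub>M (insert j I) (\<lambda>_. lborel))
     = (\<integral>\<^sup>+x. \<integral>\<^sup>+y. ennreal (gamma_density (\<Sum>i\<in>insert j I. p i) x)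
           * (ennreal (dirichlet_density I j p y)
          * F ((\<lambda>i\<in>I. x * y i)(j := x * (1 - (\<Sum>i\<in>I. y i)))))
                \<partial>Pi\<^sub>M I (\<lambda>_. lborel) \<partial>lborel)"
proof -
  let ?L = "Pi\<^sub>M I (\<lambda>_. lborel :: real measure)" and ?a = "\<Sum>i\<in>insert j I. p i"
  note I(1)[simp]
  have a: "0 < ?a" using p I by (intro sum_pos) auto
  have upd[measurable]: "(\<lambda>z. (snd z)(j := fst z)) \<in> borel \<Otimes>\<^sub>M ?L
        \<rightarrow>\<^sub>M Pi\<^sub>M (insert j I) (\<lambda>_. lborel)"
    by (rule measurable_fun_upd[where J=I]) auto
  define H where "H = (\<lambda>u y. ennreal ((\<Prod>i\<in>I. gamma_density (p i) (y i)) * gamma_density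
        (p j) u) * F (y(j := u)))"
  have Hm: "(\<lambda>z. H (fst z) (snd z)) \<in> borel_measurable (borel \<Otimes>\<^sub>M ?L)"
    unfolding H_def by measurable
  have Hm2[measurable (raw)]: "(\<lambda>w. H (f w) (g w)) \<in> borel_measurable N"
    if "f \<in> N \<rightarrow>\<^sub>M borel" "g \<in> N \<rightarrow>\<^sub>M ?L" for f g N
    using measurable_compose[OF measurable_Pair[OF that] Hm] by simp
  have prodeq: "(\<Prod>i\<in>insert j I. gamma_density (p i) ((y(j := u)) i))
      = (\<Prod>i\<in>I. gamma_density (p i) (y i)) * gamma_density (p j) u" for y u
    using I by (subst prod.insert) (auto intro!: prod.cong simp: mult.commute)
  have "(\<integral>\<^sup>+v. ennreal (\<Prod>i\<in>insert j I. gamma_density (p i) (v i)) * F v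
        \<partial>Pi\<^sub>M (insert j I) (\<lambda>_. lborel))
     = (\<integral>\<^sup>+y. \<integral>\<^sup>+u. H u y \<partial>lborel \<partial>?L)"
    using I unfolding H_def prodeq[symmetric]
    by (subst lborel_product.product_nn_integral_insert) auto
  also have "\<dots> = (\<integral>\<^sup>+y. \<integral>\<^sup>+x. H (x - (\<Sum>i\<in>I. y i)) y
        \<partial>lborel \<partial>?L)"
  proof (rule nn_integral_cong)
    fix y assume y: "y \<in> space ?L"
    have "(\<lambda>u. H u y) \<in> borel_measurable borel" using y by measurable
    from nn_integral_real_affine[OF this, of 1 "- (\<Sum>i\<in>I. y i)"]
    show "(\<integral>\<^sup>+u. H u y \<partial>lborel)
          = (\<integral>\<^sup>+x. H (x - (\<Sum>i\<in>I. y i)) y \<partial>lborel)"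
      by (simp add: algebra_simps)
  qed
  also have "\<dots> = (\<integral>\<^sup>+x. \<integral>\<^sup>+y. H (x - (\<Sum>i\<in>I. y i)) y
        \<partial>?L \<partial>lborel)"
  proof (rule pair_sigma_finite.Fubini')
    interpret fp: finite_product_sigma_finite "\<lambda>_. lborel :: real measure" I by standard simp
    show "pair_sigma_finite lborel ?L"
      using fp.sigma_finite_measure_axioms by (simp add: pair_sigma_finite_def sigma_finite_lborel)
  qed measurable
  also have "\<dots> = (\<integral>\<^sup>+x. \<integral>\<^sup>+y. ennreal (gamma_density ?a x) * (ennreal
        (dirichlet_density I j p y)
          * F ((\<lambda>i\<in>I. x * y i)(j := x * (1 - (\<Sum>i\<in>I. y i))))) \<partial>?L
                \<partial>lborel)"
  proof (rule nn_integral_cong)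
    fix x :: real
    show "(\<integral>\<^sup>+y. H (x - (\<Sum>i\<in>I. y i)) y \<partial>?L)
          = (\<integral>\<^sup>+y. ennreal (gamma_density ?a x) * (ennreal (dirichlet_density I j p y)
          * F ((\<lambda>i\<in>I. x * y i)(j := x * (1 - (\<Sum>i\<in>I. y i))))) \<partial>?L)"
    proof (cases "0 < x")
      case False
      have "H (x - (\<Sum>i\<in>I. y i)) y = 0" for y
      proof (cases "\<forall>i\<in>I. 0 < y i")
        case True
        then have "0 \<le> (\<Sum>i\<in>I. y i)" by (intro sum_nonneg) (auto intro: less_imp_le)
        then show ?thesis using False by (simp add: H_def gamma_density_def)
      next
        case False
        then have "(\<Prod>i\<in>I. gamma_density (p i) (y i)) = 0"
          by (intro prod_zero I) (auto simp: gamma_density_def)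
        then show ?thesis unfolding H_def by (simp only: mult_zero_left ennreal_0)
      qed
      then show ?thesis using False by (simp add: gamma_density_def)
    next
      case True
      have [measurable]: "(\<lambda>y. \<Sum>i\<in>I. (\<lambda>i\<in>I. x * y i) i) \<in> borel_measurable ?L"
        by (simp cong: sum.cong)
      have [measurable]: "(\<lambda>y. \<lambda>i\<in>I. x * y i) \<in> ?L \<rightarrow>\<^sub>M ?L"
        by measurable
      have "(\<integral>\<^sup>+y. H (x - (\<Sum>i\<in>I. y i)) y \<partial>?L)
         = ennreal (x ^ card I) * (\<integral>\<^sup>+y. H (x - (\<Sum>i\<in>I. (\<lambda>i\<in>I. x * y i)
               i)) (\<lambda>i\<in>I. x * y i) \<partial>?L)"
        using True by (intro nn_integral_PiM_lborel_scale) measurable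
      also have "\<dots> = (\<integral>\<^sup>+y. ennreal (x ^ card I) * H (x - (\<Sum>i\<in>I.
            (\<lambda>i\<in>I. x * y i) i)) (\<lambda>i\<in>I. x * y i) \<partial>?L)"
        by (intro nn_integral_cmult[symmetric]) measurable
      also have "\<dots> = (\<integral>\<^sup>+y. ennreal (gamma_density ?a x) * (ennreal
            (dirichlet_density I j p y)
          * F ((\<lambda>i\<in>I. x * y i)(j := x * (1 - (\<Sum>i\<in>I. y i))))) \<partial>?L)"
      proof (rule nn_integral_cong)
        fix y
        have s: "x - (\<Sum>i\<in>I. (\<lambda>i\<in>I. x * y i) i) = x * (1 - (\<Sum>i\<in>I. y i))"
          by (simp add: sum_distrib_left algebra_simps)
        have nn: "0 \<le> (\<Prod>i\<in>I. gamma_density (p i) (x * y i)) * gamma_density (p j) (x * (1 -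
              (\<Sum>i\<in>I. y i)))"
          using p by (intro mult_nonneg_nonneg prod_nonneg gamma_density_nonneg) auto
        have "ennreal (x ^ card I) * H (x - (\<Sum>i\<in>I. (\<lambda>i\<in>I. x * y i) i))
              (\<lambda>i\<in>I. x * y i)
           = ennreal (x ^ card I * ((\<Prod>i\<in>I. gamma_density (p i) (x * y i)) * gamma_density (p j)
                 (x * (1 - (\<Sum>i\<in>I. y i)))))
             * F ((\<lambda>i\<in>I. x * y i)(j := x * (1 - (\<Sum>i\<in>I. y i))))"
          unfolding H_def s using True nn by (simp add: ennreal_mult mult.assoc cong: prod.cong)
        also have "\<dots> = ennreal (dirichlet_density I j p y * gamma_density ?a x) * F
              ((\<lambda>i\<in>I. x * y i)(j := x * (1 - (\<Sum>i\<in>I. y i))))"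
          using dirichlet_density_scaling[where p=p, OF I p True] by simp
        also have "\<dots> = ennreal (gamma_density ?a x) * (ennreal (dirichlet_density I j p y) * F
              ((\<lambda>i\<in>I. x * y i)(j := x * (1 - (\<Sum>i\<in>I. y i)))))"
          using dirichlet_density_nonneg[where p=p and j=j, OF I(1) p] gamma_density_nonneg[OF a]
          by (simp add: ennreal_mult mult_ac)
        finally show "ennreal (x ^ card I) * H (x - (\<Sum>i\<in>I. (\<lambda>i\<in>I. x * y i) i))
              (\<lambda>i\<in>I. x * y i)
          = ennreal (gamma_density ?a x) * (ennreal (dirichlet_density I j p y) * F ((\<lambda>i\<in>I. x *
                y i)(j := x * (1 - (\<Sum>i\<in>I. y i)))))" .
      qed
      finally show ?thesis .
    qed
  qed
  finally show ?thesis .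
qed

lemma borel_measurable_complex_powr [measurable (raw)]:
  fixes f :: "'a \<Rightarrow> complex"
  assumes [measurable]: "f \<in> borel_measurable M"
  shows "(\<lambda>x. f x powr c) \<in> borel_measurable M"
proof -
  have [measurable]: "(\<lambda>x. Ln (f x)) \<in> borel_measurable M"
    by (rule measurable_compose[OF assms Ln_measurable])
  show ?thesis unfolding powr_def by measurable
qed

text \<open>Normalisation of the Dirichlet density follows from that of the gamma densities, by taking the
constant test function in the preceding identity.\<close>

lemma prob_space_dirichlet_density:
  assumes I: "finite I" "j \<notin> I" and p: "\<And>i. i \<in> insert j I \<Longrightarrow> 0 < p i"
  shows "prob_space (density (Pi\<^sub>M I (\<lambda>_. lborel)) (\<lambda>y. ennreal (dirichlet_density I
        j p y)))"
proof (rule prob_spaceI)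
  let ?L = "Pi\<^sub>M I (\<lambda>_. lborel :: real measure)" and ?a = "\<Sum>i\<in>insert j I. p i"
  note [measurable] = dirichlet_density_measurable[OF I(1)]
  have a: "0 < ?a" using p I by (intro sum_pos) auto
  have "(\<integral>\<^sup>+y. ennreal (dirichlet_density I j p y) \<partial>?L)
      = (\<integral>\<^sup>+x. ennreal (gamma_density ?a x)
            \<partial>lborel) * (\<integral>\<^sup>+y. ennreal (dirichlet_density I j p y) \<partial>?L)"
    using nn_integral_gamma_density[OF a] by simp
  also have "\<dots> = (\<integral>\<^sup>+x. \<integral>\<^sup>+y. ennreal (gamma_density ?a x) * (ennreal
        (dirichlet_density I j p y) * 1) \<partial>?L \<partial>lborel)"
    by (simp add: nn_integral_cmult nn_integral_multc)
  also have "\<dots> = (\<integral>\<^sup>+v. ennreal (\<Prod>i\<in>insert j I. gamma_density (p i) (v i))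
        * 1 \<partial>Pi\<^sub>M (insert j I) (\<lambda>_. lborel))"
    using nn_integral_gamma_dirichlet[where p=p, OF I p, of "\<lambda>_. 1"] by simp
  also have "\<dots> = (\<integral>\<^sup>+v. (\<Prod>i\<in>insert j I. ennreal (gamma_density (p i) (v
        i))) \<partial>Pi\<^sub>M (insert j I) (\<lambda>_. lborel))"
    using p by (intro nn_integral_cong) (subst prod_ennreal, auto intro!: gamma_density_nonneg)
  also have "\<dots> = (\<Prod>i\<in>insert j I. \<integral>\<^sup>+x. ennreal (gamma_density (p i) x)
        \<partial>lborel)"
    using I by (intro lborel_product.product_nn_integral_prod) auto
  also have "\<dots> = 1" using p by (intro prod.neutral) (auto intro: nn_integral_gamma_density)
  finally show "emeasure (density ?L (\<lambda>y. ennreal (dirichlet_density I j p y)))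
      (space (density ?L (\<lambda>y. ennreal (dirichlet_density I j p y)))) = 1"
    by (simp add: emeasure_density)
qed

text \<open>The preceding identity as an equality of measures, which opens it to complex-valued integrands.\<close>

lemma distr_gamma_dirichlet:
  assumes I: "finite I" "j \<notin> I" and p: "\<And>i. i \<in> insert j I \<Longrightarrow> 0 < p i"
  defines "G \<equiv> density lborel (\<lambda>x. ennreal (gamma_density (\<Sum>i\<in>insert j I. p i) x))"
    and "Dir \<equiv> density (Pi\<^sub>M I (\<lambda>_. lborel)) (\<lambda>y. ennreal (dirichlet_density I
          j p y))"
  shows "distr (G \<Otimes>\<^sub>M Dir) (Pi\<^sub>M (insert j I) (\<lambda>_. lborel))
           (\<lambda>z. (\<lambda>i\<in>I. fst z * snd z i)(j := fst z * (1 - (\<Sum>i\<in>I. snd z i))))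
       = density (Pi\<^sub>M (insert j I) (\<lambda>_. lborel)) (\<lambda>v. ennreal (\<Prod>i\<in>insert j
             I. gamma_density (p i) (v i)))"
    (is "distr _ ?S ?T = ?R")
    and "(\<lambda>z. (\<lambda>i\<in>I. fst z * snd z i)(j := fst z * (1 - (\<Sum>i\<in>I. snd z i))))
       \<in> G \<Otimes>\<^sub>M Dir \<rightarrow>\<^sub>M Pi\<^sub>M (insert j I) (\<lambda>_. lborel)"
proof -
  let ?L = "Pi\<^sub>M I (\<lambda>_. lborel :: real measure)"
  note [measurable] = dirichlet_density_measurable[OF I(1)] and [simp] = I(1)
  interpret Dir: prob_space Dir unfolding Dir_def by (rule prob_space_dirichlet_density[where p=p, OF I p])
  have sets_G: "sets G = sets borel" and sets_Dir: "sets Dir = sets ?L" by (simp_all add: G_def Dir_def)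
  note [measurable_cong] = sets_G sets_Dir
  show T[measurable]: "?T \<in> G \<Otimes>\<^sub>M Dir \<rightarrow>\<^sub>M ?S"
    by (rule measurable_fun_upd[where J=I]) (auto, measurable)
  show "distr (G \<Otimes>\<^sub>M Dir) ?S ?T = ?R"
  proof (rule measure_eqI)
    fix A assume "A \<in> sets (distr (G \<Otimes>\<^sub>M Dir) ?S ?T)"
    then have A[measurable]: "A \<in> sets ?S" by simp
    have T2[measurable]: "(\<lambda>y. (\<lambda>i\<in>I. x * y i)(j := x * (1 - (\<Sum>i\<in>I. y i))))
          \<in> ?L \<rightarrow>\<^sub>M ?S" for x
      by (rule measurable_fun_upd[where J=I]) (auto, measurable)
    have "emeasure (distr (G \<Otimes>\<^sub>M Dir) ?S ?T) A
          = (\<integral>\<^sup>+z. indicator A (?T z) \<partial>(G \<Otimes>\<^sub>M Dir))"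
      by (simp add: nn_integral_distr flip: nn_integral_indicator)
    also have "\<dots> = (\<integral>\<^sup>+x. \<integral>\<^sup>+y. indicator A (?T (x, y))
          \<partial>Dir \<partial>G)"
      by (intro Dir.nn_integral_fst[symmetric]) measurable
    also have "\<dots> = (\<integral>\<^sup>+x. ennreal (gamma_density (\<Sum>i\<in>insert j I. p i) x) *
          (\<integral>\<^sup>+y. indicator A (?T (x, y)) \<partial>Dir) \<partial>lborel)"
      unfolding G_def by (intro nn_integral_density) (auto simp flip: G_def, measurable)
    also have "\<dots> = (\<integral>\<^sup>+x. \<integral>\<^sup>+y. ennreal (gamma_density
          (\<Sum>i\<in>insert j I. p i) x) * (ennreal (dirichlet_density I j p y)
          * indicator A ((\<lambda>i\<in>I. x * y i)(j := x * (1 - (\<Sum>i\<in>I. y i)))))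
                \<partial>?L \<partial>lborel)"
    proof (rule nn_integral_cong)
      fix x
      have "(\<integral>\<^sup>+y. indicator A (?T (x, y)) \<partial>Dir)
         = (\<integral>\<^sup>+y. ennreal (dirichlet_density I j p y) * indicator A ((\<lambda>i\<in>I. x *
               y i)(j := x * (1 - (\<Sum>i\<in>I. y i)))) \<partial>?L)"
        unfolding Dir_def by (subst nn_integral_density) auto
      then show "ennreal (gamma_density (\<Sum>i\<in>insert j I. p i) x) * (\<integral>\<^sup>+y. indicator
            A (?T (x, y)) \<partial>Dir)
         = (\<integral>\<^sup>+y. ennreal (gamma_density (\<Sum>i\<in>insert j I. p i) x) * (ennreal
               (dirichlet_density I j p y)
          * indicator A ((\<lambda>i\<in>I. x * y i)(j := x * (1 - (\<Sum>i\<in>I. y i))))) \<partial>?L)"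
        by (simp add: nn_integral_cmult)
    qed
    also have "\<dots> = (\<integral>\<^sup>+v. ennreal (\<Prod>i\<in>insert j I. gamma_density (p i) (v
          i)) * indicator A v \<partial>?S)"
      by (rule nn_integral_gamma_dirichlet[where p=p, OF I p, symmetric]) measurable
    also have "\<dots> = emeasure ?R A" by (simp add: emeasure_density)
    finally show "emeasure (distr (G \<Otimes>\<^sub>M Dir) ?S ?T) A = emeasure ?R A" .
  qed simp
qed

text \<open>Integrate $\exp(\sum_i (1-z_i) v_i)$, with $v = xp$, in two ways. Over independent gamma coordinates it
factorises into $\prod z_i^{-p_i}$. Over total and proportions the exponent is $x (1 - \sum_i z_i p_i)$,
because the proportions sum to $1$, and the total integrates to $(\sum_i z_i p_i)^{-a}$. The summand $1$
in $1 - z_i$ compensates the factor $e^{-v_i}$ of the gamma density.\<close>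

lemma dirichlet_density_markov_krein:
  fixes z :: "nat \<Rightarrow> complex"
  assumes I: "finite I" "j \<notin> I" and p: "\<And>i. i \<in> insert j I \<Longrightarrow> 0 < p i"
    and z: "\<And>i. i \<in> insert j I \<Longrightarrow> 0 < Re (z i)"
  shows "(CLINT y|density (Pi\<^sub>M I (\<lambda>_. lborel)) (\<lambda>y. ennreal (dirichlet_density I j p y)).
            ((\<Sum>i\<in>I. z i * y i) + z j * (1 - (\<Sum>i\<in>I. y i))) powr (- of_real
                  (\<Sum>i\<in>insert j I. p i)))
       = (\<Prod>i\<in>insert j I. z i powr (- of_real (p i)))"
proof -
  let ?L = "Pi\<^sub>M I (\<lambda>_. lborel :: real measure)" and ?a = "\<Sum>i\<in>insert j I. p i"
  let ?S = "Pi\<^sub>M (insert j I) (\<lambda>_. lborel :: real measure)"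
  let ?T = "\<lambda>z. (\<lambda>i\<in>I. fst z * snd z i)(j := fst z * (1 - (\<Sum>i\<in>I. snd z i)))"
  define G where "G = density lborel (\<lambda>x. ennreal (gamma_density ?a x))"
  define Dir where "Dir = density ?L (\<lambda>y. ennreal (dirichlet_density I j p y))"
  define R where "R = density ?S (\<lambda>v. ennreal (\<Prod>i\<in>insert j I. gamma_density (p i) (v i)))"
  define \<zeta> where "\<zeta> = (\<lambda>y::nat \<Rightarrow> real. (\<Sum>i\<in>I. z i * y i) + z j *
        (1 - (\<Sum>i\<in>I. y i)))"
  note [measurable] = dirichlet_density_measurable[OF I(1)] and [simp] = I(1)
  have a: "0 < ?a" using p I by (intro sum_pos) auto
  interpret Dir: prob_space Dir unfolding Dir_def by (rule prob_space_dirichlet_density[where p=p, OF I p])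
  interpret G: prob_space G
    unfolding G_def using nn_integral_gamma_density[OF a] by (intro prob_spaceI) (simp add: emeasure_density)
  interpret P: pair_prob_space G Dir ..
  have eq: "distr (G \<Otimes>\<^sub>M Dir) ?S ?T = R"
        and T[measurable]: "?T \<in> G \<Otimes>\<^sub>M Dir \<rightarrow>\<^sub>M ?S"
    unfolding G_def Dir_def R_def
    using distr_gamma_dirichlet(1)[where p=p, OF I p] distr_gamma_dirichlet(2)[where p=p, OF I p] by blast+
  have [measurable]: "\<zeta> \<in> borel_measurable ?L" unfolding \<zeta>_def by measurable
  define E where "E = (\<lambda>v::nat \<Rightarrow> real. exp (\<Sum>i\<in>insert j I. (1 - z i) * of_real
        (v i)))"
  have [measurable]: "E \<in> borel_measurable ?S" unfolding E_def by measurable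
  have nn: "0 \<le> (\<Prod>i\<in>insert j I. gamma_density (p i) (v i))" for v
    using p by (intro prod_nonneg gamma_density_nonneg) auto
  have one: "has_bochner_integral lborel (\<lambda>x. complex_of_real (gamma_density (p i) x) * exp ((1 - z
        i) * of_real x))
     (z i powr (- of_real (p i)))" if "i \<in> insert j I" for i
    using p z that by (intro gamma_density_laplace) auto
  have prodE: "(\<Prod>i\<in>insert j I. gamma_density (p i) (v i)) *\<^sub>R E v
     = (\<Prod>i\<in>insert j I. complex_of_real (gamma_density (p i) (v i)) * exp ((1 - z i) * of_real (v
           i)))" for v
    unfolding E_def by (simp only: prod.distrib exp_sum[OF finite.insertI[OF I(1)]] scaleR_conv_of_real
          of_real_prod)
  have int_S: "integrable ?S (\<lambda>v. (\<Prod>i\<in>insert j I. gamma_density (p i) (v i)) *\<^sub>R E v)"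
    unfolding prodE using one by (intro lborel_product.product_integrable_prod)
          (auto simp: has_bochner_integral_iff)
  have int_R: "integrable R E"
    unfolding R_def using int_S nn by (subst integrable_density) auto
  have int_GD: "integrable (G \<Otimes>\<^sub>M Dir) (\<lambda>w. E (?T w))"
    using int_R unfolding eq[symmetric] by (rule integrable_distr[OF T])
  have ET: "E (?T (x, y)) = exp ((1 - \<zeta> y) * of_real x)" for x y
  proof -
    have "(\<Sum>i\<in>insert j I. (1 - z i) * of_real (?T (x, y) i))
       = (1 - z j) * of_real (x * (1 - (\<Sum>i\<in>I. y i))) + (\<Sum>i\<in>I. (1 - z i) * of_real (x * y i))"
      using I by (subst sum.insert) (auto intro!: sum.cong)
    also have "\<dots> = (1 - \<zeta> y) * of_real x"
      by (simp add: \<zeta>_def algebra_simps sum_subtractf sum.distrib sum_distrib_left)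
    finally show ?thesis unfolding E_def by (rule arg_cong)
  qed
  have int_GD': "integrable (G \<Otimes>\<^sub>M Dir) (\<lambda>(x, y). exp ((1 - \<zeta> y) * of_real x))"
    using int_GD unfolding ET[symmetric] by (simp add: case_prod_unfold)
  have sets_G[measurable_cong]: "sets G = sets borel" by (simp add: G_def)
  have m: "(\<lambda>y. CLINT x|G. exp ((1 - \<zeta> y) * of_real x)) \<in> borel_measurable ?L" by measurable
  have "(\<Prod>i\<in>insert j I. z i powr (- of_real (p i)))
      = (\<Prod>i\<in>insert j I. CLINT x|lborel. complex_of_real (gamma_density (p i) x) * exp ((1 - z i)
            * of_real x))"
    using one by (intro prod.cong) (auto simp: has_bochner_integral_iff)
  also have "\<dots> = (CLINT v|?S. (\<Prod>i\<in>insert j I. complex_of_real (gamma_density (p i) (v i)) *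
        exp ((1 - z i) * of_real (v i))))"
    using one by (intro lborel_product.product_integral_prod[symmetric]) (auto simp: has_bochner_integral_iff)
  also have "\<dots> = (CLINT v|R. E v)"
    unfolding R_def prodE[symmetric] using nn by (intro integral_density[symmetric]) auto
  also have "\<dots> = (CLINT w|G \<Otimes>\<^sub>M Dir. E (?T w))"
    unfolding eq[symmetric] by (intro integral_distr) auto
  also have "\<dots> = (CLINT w|G \<Otimes>\<^sub>M Dir. (\<lambda>(x, y). exp ((1 - \<zeta> y) * of_real
        x)) w)"
    unfolding ET[symmetric] by (simp add: case_prod_unfold)
  also have "\<dots> = (CLINT y|Dir. CLINT x|G. exp ((1 - \<zeta> y) * of_real x))"
    using P.integral_snd[OF int_GD'] by simp
  also have "\<dots> = (CLINT y|?L. dirichlet_density I j p y *\<^sub>R (CLINT x|G. exp ((1 - \<zeta> y) *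
        of_real x)))"
    unfolding Dir_def using dirichlet_density_nonneg[where p=p and j=j, OF I(1) p] m
          by (intro integral_density) auto
  also have "\<dots> = (CLINT y|?L. dirichlet_density I j p y *\<^sub>R (\<zeta> y powr (- of_real ?a)))"
  proof (rule Bochner_Integration.integral_cong[OF refl])
    fix y
    show "dirichlet_density I j p y *\<^sub>R (CLINT x|G. exp ((1 - \<zeta> y) * of_real x))
          = dirichlet_density I j p y *\<^sub>R (\<zeta> y powr (- of_real ?a))"
    proof (cases "(\<forall>i\<in>I. 0 < y i) \<and> (\<Sum>i\<in>I. y i) < 1")
      case True
      have "0 < Re (z j) * (1 - (\<Sum>i\<in>I. y i))" using True z by simp
      moreover have "0 \<le> (\<Sum>i\<in>I. Re (z i) * y i)"
        using True z by (intro sum_nonneg mult_nonneg_nonneg) (auto intro: less_imp_le)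
      ultimately have "0 < Re (\<zeta> y)" by (simp add: \<zeta>_def)
      from gamma_density_laplace[OF a this]
      have "(CLINT x|lborel. gamma_density ?a x *\<^sub>R exp ((1 - \<zeta> y) * of_real x))
            = \<zeta> y powr (- of_real ?a)"
        by (simp add: has_bochner_integral_iff scaleR_conv_of_real)
      then have "(CLINT x|G. exp ((1 - \<zeta> y) * of_real x)) = \<zeta> y powr (- of_real ?a)"
        unfolding G_def using a by (subst integral_density) (auto intro!: gamma_density_nonneg)
      then show ?thesis by simp
    next
      case False
      then have "dirichlet_density I j p y = 0" unfolding dirichlet_density_def by (rule if_not_P)
      then show ?thesis by simp
    qed
  qed
  also have "\<dots> = (CLINT y|Dir. \<zeta> y powr (- of_real ?a))"
    unfolding Dir_def using dirichlet_density_nonneg[where p=p and j=j, OF I(1) p]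
          by (intro integral_density[symmetric]) auto
  finally show ?thesis unfolding Dir_def \<zeta>_def ..
qed

text \<open>Coordinates with parameter $0$ vanish and contribute $z_i^0 = 1$, so only the coordinates with
positive parameter remain, and the last of these is the one determined by the others.\<close>

lemma dirichlet_markov_krein:
  fixes z :: "nat \<Rightarrow> complex"
  assumes nn: "\<And>i. i \<le> n \<Longrightarrow> 0 \<le> p i" and pos: "\<exists>i\<le>n. 0 < p i"
    and z: "\<And>i. i \<le> n \<Longrightarrow> 0 < Re (z i)"
  shows "(CLINT q|dirichlet n p. ((\<Sum>i<n. z i * q i) + z n * (1 - (\<Sum>i<n. q i))) powr (- of_real
        (\<Sum>i\<le>n. p i)))
       = (\<Prod>i\<le>n. z i powr (- of_real (p i)))"
proof -
  define S where "S = {i. i \<le> n \<and> 0 < p i}"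
  define j where "j = Max S"
  define I where "I = S - {j}"
  have S: "finite S" "S \<noteq> {}" using pos by (auto simp: S_def)
  then have jS: "j \<in> S" unfolding j_def by (rule Max_in)
  then have SI: "S = insert j I" "finite I" "j \<notin> I" using S by (auto simp: I_def)
  have sub: "S \<subseteq> {..n}" by (auto simp: S_def)
  have p0: "p i = 0" if "i \<in> {..n} - S" for i using that nn[of i] by (auto simp: S_def)
  define v where "v = (\<lambda>(y::nat \<Rightarrow> real) i. if i \<in> I then y i else if i
        = j then 1 - (\<Sum>l\<in>I. y l) else 0)"
  let ?Dir = "density (Pi\<^sub>M I (\<lambda>_. lborel)) (\<lambda>y. ennreal (dirichlet_density I j p y))"
  have dir: "dirichlet n p = distr ?Dir (Pi\<^sub>M {..<n} (\<lambda>_. borel)) (\<lambda>y.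
        \<lambda>i\<in>{..<n}. v y i)"
    unfolding dirichlet_def Let_def v_def I_def j_def S_def ..
  have sum_v: "(\<Sum>i\<le>n. f i * of_real (v y i))
        = (\<Sum>i\<in>I. f i * of_real (y i)) + f j * (1 - (\<Sum>i\<in>I. of_real (y i)))"
    for y and f :: "nat \<Rightarrow> complex"
  proof -
    have "(\<Sum>i\<le>n. f i * of_real (v y i)) = (\<Sum>i\<in>S. f i * of_real (v y i))"
      using sub SI by (intro sum.mono_neutral_right) (auto simp: v_def)
    also have "\<dots> = f j * of_real (v y j) + (\<Sum>i\<in>I. f i * of_real (v y i))"
      using SI by simp
    also have "(\<Sum>i\<in>I. f i * of_real (v y i)) = (\<Sum>i\<in>I. f i * of_real (y i))"
      by (intro sum.cong) (auto simp: v_def)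
    finally show ?thesis using SI(3) by (simp add: v_def)
  qed
  have last: "1 - (\<Sum>i<n. complex_of_real (v y i)) = of_real (v y n)" for y
  proof -
    have "(\<Sum>i<n. complex_of_real (v y i)) + of_real (v y n) = 1"
      using sum_v[of "\<lambda>_. 1" y] by (simp add: lessThan_Suc_atMost[symmetric])
    then show ?thesis by (metis add_diff_cancel_left')
  qed
  have int_eq: "(\<Sum>i<n. z i * of_real (v y i)) + z n * (1 - (\<Sum>i<n. complex_of_real (v y i)))
     = (\<Sum>i\<in>I. z i * y i) + z j * (1 - (\<Sum>i\<in>I. y i))" for y
    unfolding last using sum_v[of z y] by (simp add: lessThan_Suc_atMost[symmetric])
  have sum_p: "(\<Sum>i\<le>n. p i) = (\<Sum>i\<in>insert j I. p i)"
    unfolding SI(1)[symmetric] using sub p0 by (intro sum.mono_neutral_right) auto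
  have [measurable]: "(\<lambda>y. \<lambda>i\<in>{..<n}. v y i) \<in> ?Dir
        \<rightarrow>\<^sub>M Pi\<^sub>M {..<n} (\<lambda>_. borel)"
  proof (rule measurable_restrict)
    fix i
    have c: "(\<lambda>y. y l) \<in> borel_measurable (Pi\<^sub>M I (\<lambda>_. lborel :: real measure))"
          if "l \<in> I" for l
      using measurable_component_singleton[OF that, of "\<lambda>_. lborel :: real measure"] by simp
    show "(\<lambda>y. v y i) \<in> borel_measurable ?Dir"
      unfolding v_def using c by (cases "i \<in> I"; cases "i = j") auto
  qed
  have "(CLINT q|dirichlet n p. ((\<Sum>i<n. z i * q i) + z n * (1 - (\<Sum>i<n. q i))) powr (- of_real
        (\<Sum>i\<le>n. p i)))
     = (CLINT y|?Dir. ((\<Sum>i\<in>I. z i * y i) + z j * (1 - (\<Sum>i\<in>I. y i))) powr (- of_real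
           (\<Sum>i\<in>insert j I. p i)))"
    unfolding dir sum_p by (subst integral_distr) (simp_all add: int_eq)
  also have "\<dots> = (\<Prod>i\<in>insert j I. z i powr (- of_real (p i)))"
    using SI sub z S_def by (intro dirichlet_density_markov_krein) auto
  also have "\<dots> = (\<Prod>i\<le>n. z i powr (- of_real (p i)))"
    unfolding SI(1)[symmetric] using sub p0 z by (intro prod.mono_neutral_left) force+
  finally show ?thesis .
qed

section \<open>Truncation to a bounded interval\<close>

definition clamp_real :: "nat \<Rightarrow> real \<Rightarrow> real" where
  "clamp_real k x = max (- real k) (min (real k) x)"

lemma clamp_real_measurable [measurable]: "clamp_real k \<in> borel_measurable borel"
  unfolding clamp_real_def[abs_def] by measurable

lemma clamp_real_bounds: "- real k \<le> clamp_real k x" "clamp_real k x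
      \<le> real k" "\<bar>clamp_real k x\<bar> \<le> \<bar>x\<bar>"
  by (auto simp: clamp_real_def)

lemma clamp_real_tendsto: "(\<lambda>k. clamp_real k x) \<longlonglongrightarrow> x"
proof (rule tendsto_eventually)
  obtain K :: nat where "\<bar>x\<bar> \<le> real K" using real_arch_simple by blast
  then show "\<forall>\<^sub>F k in sequentially. clamp_real k x = x"
    by (intro eventually_sequentiallyI[of K]) (auto simp: clamp_real_def)
qed

text \<open>The truncated measure is an image measure, so integrals against it are integrals of truncated
functions against $\alpha$. At level $0$ this fails: the point $0$ would receive the mass of both
half-lines and hence count the atom of $\alpha$ at $0$ twice.\<close>

lemma truncated_measure_eq_distr:
  assumes sets: "sets \<alpha> = sets borel" and k: "1 \<le> k"
  shows "truncated_measure k \<alpha> = distr \<alpha> borel (clamp_real k)"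
proof (rule measure_eqI)
  have cm: "clamp_real k \<in> \<alpha> \<rightarrow>\<^sub>M borel" using sets by
        (simp cong: measurable_cong_sets)
  have space: "space \<alpha> = UNIV" using sets_eq_imp_space_eq[OF sets] by simp
  fix A assume "A \<in> sets (truncated_measure k \<alpha>)"
  then have A: "A \<in> sets borel" by simp
  define L where "L = (if - real k \<in> A then {..- real k} else {})"
  define C where "C = A \<inter> {- real k<..<real k}"
  define U where "U = (if real k \<in> A then {real k..} else {})"
  have S: "L \<in> sets \<alpha>" "C \<in> sets \<alpha>" "U \<in> sets \<alpha>" using A by
        (auto simp: sets L_def C_def U_def)
  have "clamp_real k -` A \<inter> space \<alpha> = L \<union> C \<union> U"
  proof (intro set_eqI)
    fix x
    consider "x \<le> - real k" | "real k \<le> x" | "- real k < x" "x < real k" by linarith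
    then show "x \<in> clamp_real k -` A \<inter> space \<alpha> \<longleftrightarrow> x \<in> L \<union> C
          \<union> U"
    proof cases
      case 1
      then have "clamp_real k x = - real k" using k by (simp add: clamp_real_def)
      then show ?thesis using 1 k by (auto simp: space L_def C_def U_def)
    next
      case 2
      then have "clamp_real k x = real k" using k by (simp add: clamp_real_def)
      then show ?thesis using 2 k by (auto simp: space L_def C_def U_def)
    next
      case 3
      then have "clamp_real k x = x" by (simp add: clamp_real_def)
      then show ?thesis using 3 k by (auto simp: space L_def C_def U_def)
    qed
  qed
  then have "emeasure (distr \<alpha> borel (clamp_real k)) A = emeasure \<alpha> (L \<union> C \<union> U)"
    using cm A by (simp add: emeasure_distr)
  also have "\<dots> = emeasure \<alpha> L + emeasure \<alpha> C + emeasure \<alpha> U"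
  proof -
    have "L \<inter> C = {}" "(L \<union> C) \<inter> U = {}" using k by (auto simp: L_def C_def U_def)
    then show ?thesis
      using plus_emeasure[OF S(1,2)] plus_emeasure[OF sets.Un[OF S(1,2)] S(3)] by simp
  qed
  also have "\<dots> = emeasure (truncated_measure k \<alpha>) A"
    unfolding emeasure_truncated_measure[OF sets A] by (auto simp: L_def C_def U_def)
  finally show "emeasure (truncated_measure k \<alpha>) A = emeasure (distr \<alpha> borel (clamp_real k)) A" ..
qed simp

section \<open>Means of bounded functions under the Dirichlet process\<close>

text \<open>Both arguments lie in $(-\pi/2, \pi/2)$, so their difference stays on the principal branch.\<close>

lemma Ln_divide_Re_pos:
  assumes "0 < Re u" "0 < Re w"
  shows "Ln (u / w) = Ln u - Ln w"
proof -
  have nz: "u \<noteq> 0" "w \<noteq> 0" using assms by auto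
  have "- pi < Im (Ln u - Ln w)" "Im (Ln u - Ln w) \<le> pi"
    using Re_Ln_pos_lt_imp[OF assms(1)] Re_Ln_pos_lt_imp[OF assms(2)] by (auto simp: abs_less_iff)
  from Ln_exp[OF this] show ?thesis using nz by (simp add: exp_diff)
qed

text \<open>This makes the mean of a function, and the event that it exists, random quantities under any law on
the probability measures.\<close>

lemma measurable_integral_prob_algebra:
  fixes f :: "'a \<Rightarrow> 'b::{banach, second_countable_topology}"
  assumes "f \<in> borel_measurable M" and D: "sets D = sets (prob_algebra M)"
  shows "(\<lambda>\<phi>. integral\<^sup>L \<phi> f) \<in> borel_measurable D"
    and "Measurable.pred D (\<lambda>\<phi>. integrable \<phi> f)"
proof -
  have "(\<lambda>\<phi>. integral\<^sup>L \<phi> f) \<in> borel_measurable (prob_algebra M)"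
    unfolding prob_algebra_def using assms(1)
    by (intro measurable_restrict_space1 integral_measurable_subprob_algebra)
  then show "(\<lambda>\<phi>. integral\<^sup>L \<phi> f) \<in> borel_measurable D"
    using measurable_cong_sets[OF D refl] by blast
  have "Measurable.pred (prob_algebra M) (\<lambda>\<phi>. integrable \<phi> f)"
    unfolding prob_algebra_def using assms(1)
    by (intro measurable_restrict_space1 integrable_measurable_subprob_algebra)
  then show "Measurable.pred D (\<lambda>\<phi>. integrable \<phi> f)"
    using measurable_cong_sets[OF D refl] by blast
qed

lemma integral_finite_range:
  fixes h :: "nat \<Rightarrow> 'b::{banach, second_countable_topology}"
  assumes "finite_measure \<mu>" and k[measurable]: "k \<in> \<mu>
        \<rightarrow>\<^sub>M count_space UNIV" and le: "\<And>x. k x \<le> n"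
  shows "(LINT x|\<mu>. h (k x)) = (\<Sum>i\<le>n. measure \<mu> {x \<in> space \<mu>. k x = i} *\<^sub>R h i)"
proof -
  interpret finite_measure \<mu> by fact
  have "(LINT x|\<mu>. h (k x)) = (LINT x|\<mu>. (\<Sum>i\<le>n. indicator {x \<in> space \<mu>. k x
        = i} x *\<^sub>R h i))"
  proof (rule Bochner_Integration.integral_cong[OF refl])
    fix x assume x: "x \<in> space \<mu>"
    have "(\<Sum>i\<le>n. indicator {x \<in> space \<mu>. k x = i} x *\<^sub>R h i)
          = (\<Sum>i\<le>n. if i = k x then h i else 0)"
      using x by (intro sum.cong) (auto simp: indicator_def)
    then show "h (k x) = (\<Sum>i\<le>n. indicator {x \<in> space \<mu>. k x = i} x *\<^sub>R h i)"
      using le[of x] by simp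
  qed
  also have "\<dots> = (\<Sum>i\<le>n. LINT x|\<mu>. indicator {x \<in> space \<mu>. k x = i} x *\<^sub>R h i)"
    by (intro Bochner_Integration.integral_sum integrable_scaleR_left) (auto simp: emeasure_eq_measure)
  also have "\<dots> = (\<Sum>i\<le>n. measure \<mu> {x \<in> space \<mu>. k x = i} *\<^sub>R h i)"
    by (intro sum.cong) (auto simp: emeasure_eq_measure)
  finally show ?thesis .
qed

lemma norm_powr_minus_le:
  assumes "0 < r" "r \<le> Re w" "0 < a"
  shows "cmod (w powr (- complex_of_real a)) \<le> r powr (- a)"
proof -
  have "w \<noteq> 0" "r \<le> cmod w" using assms complex_Re_le_cmod[of w] by auto
  then show ?thesis
    using norm_powr_of_real_exponent[of w "- a"] assms by (simp add: powr_mono2')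
qed

context
  fixes a :: real and \<alpha> :: "real measure" and D :: "real measure measure"
  assumes a: "0 < a" and sets_\<alpha>: "sets \<alpha> = sets borel" and mass: "emeasure \<alpha> UNIV
        = ennreal a"
    and law: "dirichlet_process_law \<alpha> D"
begin

lemma sets_dirichlet_process: "sets D = sets (prob_algebra borel)"
      and prob_space_dirichlet_process: "prob_space D"
  using law by (auto simp: dirichlet_process_law_def)

lemma in_space_dirichlet_process: "\<phi> \<in> space D
      \<Longrightarrow> prob_space \<phi> \<and> sets \<phi> = sets borel \<and> space \<phi> = UNIV"
  using sets_eq_imp_space_eq[OF sets_dirichlet_process] sets_eq_imp_space_eq[of \<phi> borel] by
        (auto simp: space_prob_algebra)

lemma space_parameter: "space \<alpha> = UNIV"
  using sets_eq_imp_space_eq[OF sets_\<alpha>] by simp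

lemma finite_measure_parameter: "finite_measure \<alpha>"
  using mass by (intro finite_measureI) (simp add: space_parameter)

text \<open>A function with finitely many values is recorded by a label \<open>k\<close> of the value and the list \<open>r\<close> of
values. The level sets of \<open>k\<close> partition the line, so the definition of the process applies to them.\<close>

lemma markov_krein_finite_range:
  fixes k :: "real \<Rightarrow> nat" and r :: "nat \<Rightarrow> real"
  assumes k: "k \<in> borel \<rightarrow>\<^sub>M count_space UNIV" and le: "\<And>x. k x \<le> n"
        and r: "\<And>i. 0 \<le> r i"
    and c: "0 < Re c" and d: "0 \<le> Re d"
  shows "(CLINT \<phi>|D. (c + d * (LINT x|\<phi>. r (k x))) powr (- of_real a))
       = exp (- (CLINT x|\<alpha>. Ln (c + d * r (k x))))"
proof -
  interpret D: prob_space D by (rule prob_space_dirichlet_process)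
  interpret \<alpha>: finite_measure \<alpha> by (rule finite_measure_parameter)
  define C where "C = (\<lambda>i. {x. k x = i})"
  define z where "z = (\<lambda>i. c + d * of_real (r i))"
  define p where "p = (\<lambda>i. measure \<alpha> (C i))"
  have z: "0 < Re (z i)" for i using c d r[of i] by (simp add: z_def add_pos_nonneg)
  then have z0: "z i \<noteq> 0" for i by (metis less_irrefl zero_complex.simps(1))
  have C: "C i \<in> sets borel" for i
    using measurable_sets[OF k, of "{i}"] by (simp add: C_def vimage_def)
  have disj: "disjoint_family_on C {..n}" by (auto simp: disjoint_family_on_def C_def)
  have cover: "(\<Union>i\<le>n. C i) = UNIV" using le by (auto simp: C_def)
  have total: "(\<Sum>i\<le>n. measure \<mu> (C i))
        = measure \<mu> UNIV" if "finite_measure \<mu>" "sets \<mu> = sets borel" for \<mu>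
  proof -
    interpret finite_measure \<mu> by fact
    show ?thesis unfolding cover[symmetric]
      using C that disj by (intro finite_measure_finite_Union[symmetric]) auto
  qed
  have sum_p: "(\<Sum>i\<le>n. p i) = a"
    using total[OF finite_measure_parameter sets_\<alpha>] mass a by (simp add: p_def measure_def)
  have pos: "\<exists>i\<le>n. 0 < p i"
  proof (rule ccontr)
    assume "\<not> ?thesis"
    then have "(\<Sum>i\<le>n. p i) \<le> 0" by (intro sum_nonpos) (auto simp: not_less)
    then show False using sum_p a by simp
  qed
  define g where "g = (\<lambda>q. ((\<Sum>i<n. z i * of_real (q i)) + z n * (1 - (\<Sum>i<n.
        complex_of_real (q i)))) powr (- of_real a))"
  have [measurable]: "g \<in> borel_measurable (Pi\<^sub>M {..<n} (\<lambda>_. borel))" unfolding g_def by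
        measurable
  have meas: "(\<lambda>\<phi>. \<lambda>i\<in>{..<n}. measure \<phi> (C i)) \<in> D
        \<rightarrow>\<^sub>M Pi\<^sub>M {..<n} (\<lambda>_. borel)"
    using C sets_dirichlet_process by (intro measurable_restrict)
          (simp add: measurable_cong_sets[OF sets_dirichlet_process refl])
  have "distr D (Pi\<^sub>M {..<n} (\<lambda>_. borel)) (\<lambda>\<phi>. \<lambda>i\<in>{..<n}. measure
        \<phi> (C i)) = dirichlet n p"
    using law C disj cover unfolding dirichlet_process_law_def p_def by blast
  then have "(CLINT q|dirichlet n p. g q) = (CLINT \<phi>|D. g (\<lambda>i\<in>{..<n}. measure \<phi> (C i)))"
    using integral_distr[OF meas, of g] by simp
  moreover have "g (\<lambda>i\<in>{..<n}. measure \<phi> (C i))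
        = (c + d * (LINT x|\<phi>. r (k x))) powr (- of_real a)"
    if "\<phi> \<in> space D" for \<phi>
  proof -
    interpret \<phi>: prob_space \<phi> using in_space_dirichlet_process[OF that] by simp
    have s: "sets \<phi> = sets borel" "space \<phi> = UNIV" using in_space_dirichlet_process[OF that] by auto
    have k': "k \<in> \<phi> \<rightarrow>\<^sub>M count_space UNIV" using k s by
          (simp cong: measurable_cong_sets)
    have tot: "(\<Sum>i\<le>n. measure \<phi> (C i)) = 1"
      using total[OF \<phi>.finite_measure_axioms s(1)] \<phi>.prob_space s by simp
    have last: "1 - (\<Sum>i<n. complex_of_real (measure \<phi> (C i))) = of_real (measure \<phi> (C n))"
    proof -
      have "(\<Sum>i<n. complex_of_real (measure \<phi> (C i))) + of_real (measure \<phi> (C n))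
            = of_real (\<Sum>i\<le>n. measure \<phi> (C i))"
        by (simp add: lessThan_Suc_atMost[symmetric])
      then show ?thesis using tot by (metis add_diff_cancel_left' of_real_1)
    qed
    have "(\<Sum>i<n. z i * of_real (measure \<phi> (C i))) + z n * of_real (measure \<phi> (C n))
       = (\<Sum>i\<le>n. (c + d * of_real (r i)) * of_real (measure \<phi> (C i)))"
      by (simp add: lessThan_Suc_atMost[symmetric] z_def)
    also have "\<dots> = c * of_real (\<Sum>i\<le>n. measure \<phi> (C i)) + d * of_real (\<Sum>i\<le>n.
          measure \<phi> (C i) * r i)"
      by (simp add: algebra_simps sum.distrib sum_distrib_left)
    also have "(\<Sum>i\<le>n. measure \<phi> (C i) * r i) = (LINT x|\<phi>. r (k x))"
      using integral_finite_range[OF \<phi>.finite_measure_axioms k' le, of r] s by (simp add: C_def)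
    finally show ?thesis
      unfolding g_def using last tot by (simp cong: sum.cong_simp)
  qed
  ultimately have "(CLINT \<phi>|D. (c + d * (LINT x|\<phi>. r (k x))) powr (- of_real a))
        = (CLINT q|dirichlet n p. g q)"
    by (simp cong: Bochner_Integration.integral_cong)
  also have "\<dots> = (\<Prod>i\<le>n. z i powr (- of_real (p i)))"
    using dirichlet_markov_krein[of n p z] pos z unfolding g_def sum_p by (simp add: p_def)
  also have "\<dots> = exp (\<Sum>i\<le>n. - of_real (p i) * Ln (z i))"
    unfolding exp_sum[OF finite_atMost] using z0 by (intro prod.cong) (auto simp: powr_def)
  also have "(\<Sum>i\<le>n. - of_real (p i) * Ln (z i)) = - (CLINT x|\<alpha>. Ln (z (k x)))"
  proof -
    have "k \<in> \<alpha> \<rightarrow>\<^sub>M count_space UNIV" using k sets_\<alpha> by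
          (simp cong: measurable_cong_sets)
    from integral_finite_range[OF finite_measure_parameter this le, of "\<lambda>i. Ln (z i)"] show ?thesis
      by (simp add: p_def C_def space_parameter scaleR_conv_of_real sum_negf)
  qed
  finally show ?thesis by (simp add: z_def)
qed

text \<open>Round $f$ down to multiples of $1/(n+1)$. The values stay in $[0,M]$, so $c + d f$ keeps real part at
least Re $c$; this makes the powers and logarithms bounded and continuous along the approximation.\<close>

lemma markov_krein_bounded:
  fixes f :: "real \<Rightarrow> real" and M :: nat
  assumes f[measurable]: "f \<in> borel_measurable borel" and bounds: "\<And>x. 0
        \<le> f x" "\<And>x. f x \<le> real M"
    and c: "0 < Re c" and d: "0 \<le> Re d"
  shows "(CLINT \<phi>|D. (c + d * (LINT x|\<phi>. f x)) powr (- of_real a))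
        = exp (- (CLINT x|\<alpha>. Ln (c + d * f x)))"
proof -
  interpret D: prob_space D by (rule prob_space_dirichlet_process)
  interpret \<alpha>: finite_measure \<alpha> by (rule finite_measure_parameter)
  define k where "k = (\<lambda>n x. nat \<lfloor>real (Suc n) * f x\<rfloor>)"
  define r where "r = (\<lambda>n i. real i / real (Suc n))"
  have k[measurable]: "k n \<in> borel
        \<rightarrow>\<^sub>M count_space UNIV" for n unfolding k_def by measurable
  have k_le: "k n x \<le> Suc n * M" for n x
  proof -
    have "real (Suc n) * f x \<le> real (Suc n) * real M" using bounds by (intro mult_left_mono) auto
    then have "\<lfloor>real (Suc n) * f x\<rfloor> \<le> int (Suc n * M)"
      by (metis floor_mono floor_of_nat of_nat_mult)
    then show ?thesis by (simp only: k_def nat_le_iff)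
  qed
  have real_k: "real (k n x) = of_int \<lfloor>real (Suc n) * f x\<rfloor>" for n x
    using bounds(1)[of x] by (simp add: k_def)
  have rk_le: "r n (k n x) \<le> f x" for n x
    unfolding r_def real_k by (simp add: pos_divide_le_eq mult.commute del: of_nat_Suc)
  have rk_ge: "f x - 1 / real (Suc n) \<le> r n (k n x)" for n x
  proof -
    have "real (Suc n) * f x - 1 \<le> real (k n x)" unfolding real_k by linarith
    then have "(real (Suc n) * f x - 1) / real (Suc n) \<le> real (k n x) / real (Suc n)"
      by (intro divide_right_mono) auto
    then show ?thesis by (simp add: r_def diff_divide_distrib del: of_nat_Suc)
  qed
  have rk_0: "0 \<le> r n (k n x)" for n x by (simp add: r_def)
  have rk_M: "r n (k n x) \<le> real M" for n x using rk_le bounds(2) order_trans by blast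
  have conv: "(\<lambda>n. r n (k n x)) \<longlonglongrightarrow> f x" for x
  proof (rule tendsto_sandwich)
    show "(\<lambda>n. f x - 1 / real (Suc n)) \<longlonglongrightarrow> f x"
      using tendsto_diff[OF tendsto_const LIMSEQ_inverse_real_of_nat, of "f x"] by (simp add: inverse_eq_divide)
  qed (use rk_ge rk_le in auto)
  have rk_m[measurable]: "(\<lambda>x. r n (k n x)) \<in> borel_measurable borel" for n
    unfolding r_def by measurable
  have Re_pos: "Re c \<le> Re (c + d * of_real t)" if "0 \<le> t" for t using d that by simp
  have nonpos: "c + d * of_real t \<notin> \<real>\<^sub>\<le>\<^sub>0" if "0 \<le> t" for t
    using Re_pos[OF that] c by (auto simp: complex_nonpos_Reals_iff)
  have "(\<lambda>n. CLINT \<phi>|D. (c + d * (LINT x|\<phi>. r n (k n x))) powr (- of_real a))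
      \<longlonglongrightarrow> (CLINT \<phi>|D. (c + d * (LINT x|\<phi>. f x)) powr (- of_real a))"
  proof (rule integral_dominated_convergence[where w="\<lambda>_. Re c powr (- a)"])
    note [measurable] = measurable_integral_prob_algebra(1)[OF f sets_dirichlet_process]
          measurable_integral_prob_algebra(1)[OF rk_m sets_dirichlet_process]
    show "(\<lambda>\<phi>. (c + d * (LINT x|\<phi>. f x)) powr (- of_real a)) \<in> borel_measurable D" by
          measurable
    show "(\<lambda>\<phi>. (c + d * (LINT x|\<phi>. r n (k n x))) powr (- of_real a)) \<in>
          borel_measurable D" for n by measurable
    show "AE \<phi> in D. (\<lambda>n. (c + d * (LINT x|\<phi>. r n (k n x))) powr (- of_real a))
          \<longlonglongrightarrow> (c + d * (LINT x|\<phi>. f x)) powr (- of_real a)"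
    proof (rule AE_I2)
      fix \<phi> assume \<phi>: "\<phi> \<in> space D"
      interpret \<phi>: prob_space \<phi> using in_space_dirichlet_process[OF \<phi>] by simp
      have [measurable_cong]: "sets \<phi> = sets borel" using in_space_dirichlet_process[OF \<phi>] by simp
      have "(\<lambda>n. LINT x|\<phi>. r n (k n x)) \<longlonglongrightarrow> (LINT x|\<phi>. f x)"
      proof (rule integral_dominated_convergence[where w="\<lambda>_. real M"])
        show "AE x in \<phi>. norm (r n (k n x)) \<le> real M" for n using rk_0 rk_M by simp
      qed (use conv in auto)
      then show "(\<lambda>n. (c + d * (LINT x|\<phi>. r n (k n x))) powr (- of_real a))
            \<longlonglongrightarrow> (c + d * (LINT x|\<phi>. f x)) powr (- of_real a)"
        using bounds(1) by (intro tendsto_powr_complex tendsto_intros nonpos integral_nonneg_AE) auto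
    qed
    show "AE \<phi> in D. norm ((c + d * (LINT x|\<phi>. r n (k n x))) powr (- of_real a))
          \<le> Re c powr (- a)" for n
      using rk_0 by (intro AE_I2 norm_powr_minus_le c a Re_pos integral_nonneg_AE) auto
  qed auto
  moreover have "(\<lambda>n. exp (- (CLINT x|\<alpha>. Ln (c + d * r n (k n x)))))
        \<longlonglongrightarrow> exp (- (CLINT x|\<alpha>. Ln (c + d * f x)))"
  proof -
    have "compact ((\<lambda>t. Ln (c + d * of_real t)) ` {0..real M})"
      using nonpos by (intro compact_continuous_image continuous_intros) auto
    then obtain B where B: "\<And>t. t \<in> {0..real M}
          \<Longrightarrow> cmod (Ln (c + d * of_real t)) \<le> B"
      using compact_imp_bounded by (fastforce simp: bounded_iff)
    note [measurable_cong] = sets_\<alpha>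
    have Ln_m[measurable]: "(\<lambda>x. Ln (c + d * of_real (h x))) \<in> borel_measurable \<alpha>" if "h
          \<in> borel_measurable borel" for h
      using that sets_\<alpha> by (intro measurable_compose[OF _ Ln_measurable])
            (simp cong: measurable_cong_sets)
    have "(\<lambda>n. CLINT x|\<alpha>. Ln (c + d * r n (k n x)))
          \<longlonglongrightarrow> (CLINT x|\<alpha>. Ln (c + d * f x))"
    proof (rule integral_dominated_convergence[where w="\<lambda>_. B"])
      show "AE x in \<alpha>. (\<lambda>n. Ln (c + d * r n (k n x))) \<longlonglongrightarrow> Ln (c + d * f x)"
        using conv bounds nonpos by (intro AE_I2 tendsto_Ln tendsto_intros) auto
      show "AE x in \<alpha>. cmod (Ln (c + d * r n (k n x))) \<le> B" for n
        using rk_0 rk_M by (intro AE_I2 B) auto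
    qed (use Ln_m in auto)
    then show ?thesis by (intro tendsto_intros)
  qed
  moreover have "(CLINT \<phi>|D. (c + d * (LINT x|\<phi>. r n (k n x))) powr (- of_real a))
        = exp (- (CLINT x|\<alpha>. Ln (c + d * r n (k n x))))" for n
    using k k_le[of n] c d by (intro markov_krein_finite_range) (auto simp: r_def)
  ultimately show ?thesis by (simp add: LIMSEQ_unique)
qed

section \<open>Almost sure existence of the mean\<close>

text \<open>If $\varphi$ has no first absolute moment, the means of $f_k = \min(|x|,k)$ increase to infinity and
$(1 + s \varphi(f_k))^{-a}$ tends to $0$; otherwise this quantity is at most $1$. Hence its expectation,
which is at least $\exp(-\int\log(1+s|x|)\,d\alpha)$ for every $k$, is asymptotically bounded by the
probability of a finite moment.\<close>

lemma integrable_under_dirichlet_process: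
  assumes log: "integrable \<alpha> (\<lambda>x. ln (1 + \<bar>x\<bar>))"
  shows "AE \<phi> in D. integrable \<phi> (\<lambda>x. x)"
proof -
  interpret D: prob_space D by (rule prob_space_dirichlet_process)
  interpret \<alpha>: finite_measure \<alpha> by (rule finite_measure_parameter)
  define f where "f = (\<lambda>k x. min \<bar>x\<bar> (real k))"
  have f[measurable]: "f k \<in> borel_measurable borel" and f_bounds: "0 \<le> f k x" "f k x
        \<le> real k" "f k x \<le> \<bar>x\<bar>" for k x
    unfolding f_def by auto
  note [measurable] = measurable_integral_prob_algebra(1)[OF f sets_dirichlet_process]
  define A where "A = {\<phi>\<in>space D. integrable \<phi> (\<lambda>x. x)}"
  have A[measurable]: "A \<in> sets D"
    unfolding A_def using measurable_integral_prob_algebra(2)[OF _ sets_dirichlet_process, of "\<lambda>x.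
          x"] by simp
  have mean_0: "0 \<le> (LINT x|\<phi>. f k x)" for \<phi> k
    using f_bounds by (intro integral_nonneg_AE) auto
  have \<alpha>_m: "(\<lambda>x. ln (1 + s * g x)) \<in> borel_measurable \<alpha>" if "g \<in>
        borel_measurable borel" for s and g :: "real \<Rightarrow> real"
    using that sets_\<alpha> by (simp cong: measurable_cong_sets)
  have lower: "exp (- (LINT x|\<alpha>. ln (1 + s * \<bar>x\<bar>)))
        \<le> measure D A" if s: "0 < s" "s \<le> 1" for s
  proof -
    define u where "u = (\<lambda>k \<phi>. (1 + s * (LINT x|\<phi>. f k x)) powr (- a))"
    have u_m[measurable]: "u k \<in> borel_measurable D" for k unfolding u_def by measurable
    have u_bounds: "0 \<le> u k \<phi>" "u k \<phi> \<le> 1" for k \<phi>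
    proof -
      have "1 \<le> 1 + s * (LINT x|\<phi>. f k x)" using s mean_0[of \<phi> k] by simp
      then have "u k \<phi> \<le> 1 powr (- a)" unfolding u_def using a by (intro powr_mono2') auto
      then show "0 \<le> u k \<phi>" "u k \<phi> \<le> 1" by (simp_all add: u_def)
    qed
    have int: "integrable \<alpha> (\<lambda>x. ln (1 + s * \<bar>x\<bar>))"
      using log
    proof (rule Bochner_Integration.integrable_bound)
      show "AE x in \<alpha>. norm (ln (1 + s * \<bar>x\<bar>)) \<le> norm (ln (1 + \<bar>x\<bar>))"
        using s by (intro AE_I2) (auto simp: ln_mono mult_left_le_one_le add_pos_nonneg)
    qed (rule \<alpha>_m, simp)
    have E_u: "exp (- (LINT x|\<alpha>. ln (1 + s * \<bar>x\<bar>))) \<le> (LINT \<phi>|D. u k \<phi>)" for k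
    proof -
      have u_complex: "complex_of_real (u k \<phi>)
            = (1 + complex_of_real s * complex_of_real (LINT x|\<phi>. f k x)) powr (- complex_of_real a)"
            for \<phi>
        using powr_of_real[of "1 + s * (LINT x|\<phi>. f k x)" "- a"] s mean_0[of \<phi> k] by (simp add: u_def)
      have Ln_complex: "Ln (1 + complex_of_real s * complex_of_real (f k x))
            = complex_of_real (ln (1 + s * f k x))" for x
      proof -
        have "0 < 1 + s * f k x" using s f_bounds(1)[of k x] by (intro add_pos_nonneg) auto
        then show ?thesis using Ln_of_real[of "1 + s * f k x"] by simp
      qed
      have "complex_of_real (LINT \<phi>|D. u k \<phi>)
            = (CLINT \<phi>|D. (1 + complex_of_real s * complex_of_real (LINT x|\<phi>. f k x)) powr (-
            complex_of_real a))"
        by (subst integral_complex_of_real[symmetric], rule Bochner_Integration.integral_cong[OF refl])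
              (rule u_complex)
      also have "\<dots> = exp (- (CLINT x|\<alpha>. Ln (1 + complex_of_real s * complex_of_real (f k x))))"
        using f_bounds s by (intro markov_krein_bounded[where M=k]) auto
      also have "(CLINT x|\<alpha>. Ln (1 + complex_of_real s * complex_of_real (f k x)))
            = of_real (LINT x|\<alpha>. ln (1 + s * f k x))"
        unfolding Ln_complex by (rule integral_complex_of_real)
      finally have "(LINT \<phi>|D. u k \<phi>) = exp (- (LINT x|\<alpha>. ln (1 + s * f k x)))"
        by (simp only: of_real_minus[symmetric] exp_of_real of_real_eq_iff)
      moreover have "(LINT x|\<alpha>. ln (1 + s * f k x)) \<le> (LINT x|\<alpha>. ln (1 + s * \<bar>x\<bar>))"
      proof (rule integral_mono_AE')
        show "AE x in \<alpha>. ln (1 + s * f k x) \<le> ln (1 + s * \<bar>x\<bar>)"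
          using s f_bounds by (intro AE_I2 ln_mono) (auto intro!: mult_left_mono add_pos_nonneg)
        show "AE x in \<alpha>. 0 \<le> ln (1 + s * \<bar>x\<bar>)"
          using s by (intro AE_I2 ln_ge_zero) auto
      qed (rule int)
      ultimately show ?thesis by simp
    qed
    have lim: "(\<lambda>k. LINT \<phi>|D. indicator (space D - A) \<phi> * u k \<phi>)
          \<longlonglongrightarrow> (LINT \<phi>|D. 0)"
    proof (rule integral_dominated_convergence[where w="\<lambda>_. 1"])
      show "AE \<phi> in D. (\<lambda>k. indicator (space D - A) \<phi> * u k \<phi>)
            \<longlonglongrightarrow> 0"
      proof (rule AE_I2)
        fix \<phi> assume \<phi>: "\<phi> \<in> space D"
        show "(\<lambda>k. indicator (space D - A) \<phi> * u k \<phi>) \<longlonglongrightarrow> 0"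
        proof (cases "\<phi> \<in> A")
          case False
          interpret \<phi>: prob_space \<phi> using in_space_dirichlet_process[OF \<phi>] by simp
          have [measurable_cong]: "sets \<phi> = sets borel" using in_space_dirichlet_process[OF \<phi>] by simp
          have "\<not> integrable \<phi> (\<lambda>x. x)" using False \<phi> by (simp add: A_def)
          then have top: "(\<integral>\<^sup>+x. ennreal \<bar>x\<bar> \<partial>\<phi>) = \<infinity>"
            by (auto simp: integrable_iff_bounded less_top[symmetric])
          have "(\<lambda>k. \<integral>\<^sup>+x. ennreal (f k x)
                \<partial>\<phi>) \<longlonglongrightarrow> (\<integral>\<^sup>+x. ennreal \<bar>x\<bar>
                \<partial>\<phi>)"
          proof (rule nn_integral_LIMSEQ)
            show "incseq (\<lambda>k x. ennreal (f k x))"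
              by (auto simp: incseq_def le_fun_def f_def intro!: ennreal_leI)
            show "(\<lambda>k. ennreal (f k x)) \<longlonglongrightarrow> ennreal \<bar>x\<bar>" for x
            proof (intro tendsto_ennrealI tendsto_eventually)
              obtain K :: nat where "\<bar>x\<bar> \<le> real K" using real_arch_simple by blast
              then show "\<forall>\<^sub>F k in sequentially. f k x = \<bar>x\<bar>"
                by (intro eventually_sequentiallyI[of K]) (auto simp: f_def min_def)
            qed
          qed simp
          moreover have "(\<integral>\<^sup>+x. ennreal (f k x) \<partial>\<phi>)
                = ennreal (LINT x|\<phi>. f k x)" for k
          proof (rule nn_integral_eq_integral)
            show "integrable \<phi> (f k)"
              using f_bounds by (intro \<phi>.integrable_const_bound[of _ "real k"]) auto
          qed (use f_bounds in auto)
          ultimately have "filterlim (\<lambda>k. LINT x|\<phi>. f k x) at_top sequentially"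
            by (simp add: top flip: ennreal_tendsto_top_eq_at_top)
          then have "filterlim (\<lambda>k. 1 + s * (LINT x|\<phi>. f k x)) at_top sequentially"
            using s by (intro filterlim_tendsto_add_at_top[OF tendsto_const]
                  filterlim_tendsto_pos_mult_at_top[OF tendsto_const])
          then have "(\<lambda>k. u k \<phi>) \<longlonglongrightarrow> 0"
            unfolding u_def using a by (intro tendsto_neg_powr) auto
          then show ?thesis by (rule tendsto_mult_right_zero)
        qed simp
      qed
      show "AE \<phi> in D. norm (indicator (space D - A) \<phi> * u k \<phi>) \<le> 1" for k
        using u_bounds[of k] by (intro AE_I2) (auto simp: indicator_def)
    qed auto
    have "exp (- (LINT x|\<alpha>. ln (1 + s * \<bar>x\<bar>)))
          \<le> measure D A + (LINT \<phi>|D. indicator (space D - A) \<phi> * u k \<phi>)" for k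
    proof -
      have i: "integrable D (\<lambda>\<phi>. indicator (space D - A) \<phi> * u k \<phi>)"
        using u_bounds[of k] by (intro D.integrable_const_bound[of _ 1]) (auto simp: indicator_def)
      have "(LINT \<phi>|D. u k \<phi>)
            \<le> (LINT \<phi>|D. indicator A \<phi> + indicator (space D - A) \<phi> * u k \<phi>)"
      proof (rule integral_mono)
        show "integrable D (u k)" using u_bounds[of k] by (intro D.integrable_const_bound[of _ 1]) auto
        show "integrable D (\<lambda>\<phi>. indicator A \<phi> + indicator (space D - A) \<phi> * u k \<phi>)"
          using i by (intro Bochner_Integration.integrable_add) (auto simp: D.emeasure_eq_measure)
      qed (use u_bounds[of k] in \<open>auto simp: indicator_def\<close>)
      also have "\<dots> = measure D A + (LINT \<phi>|D. indicator (space D - A) \<phi> * u k \<phi>)"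
        using i by (subst Bochner_Integration.integral_add) (auto simp: D.emeasure_eq_measure)
      finally show ?thesis using E_u[of k] by linarith
    qed
    moreover have "(\<lambda>k. measure D A + (LINT \<phi>|D. indicator (space D - A) \<phi> * u k \<phi>))
          \<longlonglongrightarrow> measure D A + 0"
      using lim by (intro tendsto_intros) simp
    ultimately show ?thesis by (intro LIMSEQ_le_const[of _ "measure D A"]) auto
  qed
  \<comment> \<open>let \<open>s
        = 1 / (n + 1)\<close> tend to \<open>0\<close>; the logarithmic moment of \<open>\<alpha>\<close>
        dominates\<close>
  have "(\<lambda>n. LINT x|\<alpha>. ln (1 + inverse (real (Suc n)) * \<bar>x\<bar>))
        \<longlonglongrightarrow> (LINT x|\<alpha>. 0)"
  proof (rule integral_dominated_convergence[where w="\<lambda>x. ln (1 + \<bar>x\<bar>)"])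
    show "AE x in \<alpha>. (\<lambda>n. ln (1 + inverse (real (Suc n)) * \<bar>x\<bar>))
          \<longlonglongrightarrow> 0"
    proof (rule AE_I2)
      fix x :: real
      have "(\<lambda>n. ln (1 + inverse (real (Suc n)) * \<bar>x\<bar>))
            \<longlonglongrightarrow> ln (1 + 0 * \<bar>x\<bar>)"
        by (intro tendsto_intros LIMSEQ_inverse_real_of_nat) auto
      then show "(\<lambda>n. ln (1 + inverse (real (Suc n)) * \<bar>x\<bar>))
            \<longlonglongrightarrow> 0" by simp
    qed
    show "AE x in \<alpha>. norm (ln (1 + inverse (real (Suc n)) * \<bar>x\<bar>))
          \<le> ln (1 + \<bar>x\<bar>)" for n
    proof (rule AE_I2)
      fix x :: real
      have "inverse (real (Suc n)) * \<bar>x\<bar> \<le> 1 * \<bar>x\<bar>"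
        by (intro mult_right_mono) (auto simp: inverse_le_1_iff)
      then have "ln (1 + inverse (real (Suc n)) * \<bar>x\<bar>) \<le> ln (1 + \<bar>x\<bar>)"
        by (intro ln_mono add_pos_nonneg) auto
      moreover have "0 \<le> ln (1 + inverse (real (Suc n)) * \<bar>x\<bar>)" by (intro ln_ge_zero) simp
      ultimately show "norm (ln (1 + inverse (real (Suc n)) * \<bar>x\<bar>))
            \<le> ln (1 + \<bar>x\<bar>)" by simp
    qed
  qed (use log \<alpha>_m[of abs] in auto)
  then have "(\<lambda>n. exp (- (LINT x|\<alpha>. ln (1 + inverse (real (Suc n)) * \<bar>x\<bar>))))
        \<longlonglongrightarrow> exp (- 0)"
    by (intro tendsto_intros) simp
  then have "exp (- 0) \<le> measure D A"
    by (rule LIMSEQ_le_const2) (auto intro!: lower simp: inverse_le_1_iff)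
  then have "measure D A = 1" using D.prob_le_1[of A] by simp
  then have "AE \<phi> in D. \<phi> \<in> A" using A by (simp add: D.AE_in_set_eq_1)
  then show ?thesis by eventually_elim (simp add: A_def)
qed

section \<open>Characteristic functions of truncated means\<close>

text \<open>Since $Ln(1 - itx/w) = Ln(w - itx) - Ln\,w$ and $\alpha$ has mass $a$, the factor $w^{-a}$ cancels the
contribution of $Ln\,w$. What remains is the Markov-Krein identity for the truncated identity.\<close>

lemma markov_krein_truncated:
  assumes k: "1 \<le> k" and w: "0 < Re w"
  shows "exp (- (LINT x|truncated_measure k \<alpha>. Ln (1 - \<i> * of_real t * of_real x / w))) / w powr
        of_real a
       = (CLINT \<phi>|D. (w - \<i> * of_real (t * (LINT x|\<phi>. clamp_real k x))) powr (- of_real a))"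
proof -
  interpret D: prob_space D by (rule prob_space_dirichlet_process)
  interpret \<alpha>: finite_measure \<alpha> by (rule finite_measure_parameter)
  note [measurable_cong] = sets_\<alpha>
  have Re_pos: "0 < Re (w - \<i> * of_real (t * y))" for y using w by simp
  have [measurable]: "(\<lambda>x. Ln (w - \<i> * of_real (t * h x))) \<in> borel_measurable borel"
        "(\<lambda>x. Ln (1 - \<i> * of_real t * of_real (h x) / w)) \<in> borel_measurable borel"
    if "h \<in> borel_measurable borel" for h :: "real \<Rightarrow> real"
    using that by (intro measurable_compose[OF _ Ln_measurable]; simp)+
  have int: "integrable \<alpha> (\<lambda>x. Ln (w - \<i> * of_real (t * clamp_real k x)))"
  proof -
    have "compact ((\<lambda>y. Ln (w - \<i> * of_real (t * y))) ` {- real k..real k})"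
      using Re_pos by (intro compact_continuous_image continuous_intros)
            (auto simp: complex_nonpos_Reals_iff not_le)
    then obtain B where "\<And>y. y \<in> {- real k..real k}
          \<Longrightarrow> cmod (Ln (w - \<i> * of_real (t * y))) \<le> B"
      using compact_imp_bounded by (fastforce simp: bounded_iff)
    then show ?thesis
      using clamp_real_bounds[of k] by (intro \<alpha>.integrable_const_bound[of _ B]) auto
  qed
  have "(LINT x|truncated_measure k \<alpha>. Ln (1 - \<i> * of_real t * of_real x / w))
     = (CLINT x|\<alpha>. Ln (1 - \<i> * of_real t * of_real (clamp_real k x) / w))"
    unfolding truncated_measure_eq_distr[OF sets_\<alpha> k] by (intro integral_distr) auto
  also have "\<dots> = (CLINT x|\<alpha>. Ln (w - \<i> * of_real (t * clamp_real k x)) - Ln w)"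
  proof (intro Bochner_Integration.integral_cong refl)
    fix x
    have "1 - \<i> * of_real t * of_real (clamp_real k x) / w = (w - \<i> * of_real (t * clamp_real k x)) / w"
      using w by (subst diff_divide_distrib) auto
    then show "Ln (1 - \<i> * of_real t * of_real (clamp_real k x) / w)
          = Ln (w - \<i> * of_real (t * clamp_real k x)) - Ln w"
      using Ln_divide_Re_pos[OF Re_pos w] by simp
  qed
  also have "\<dots> = (CLINT x|\<alpha>. Ln (w - \<i> * of_real (t * clamp_real k x))) - of_real a * Ln w"
    using int mass a by (simp add: measure_def space_parameter scaleR_conv_of_real)
  finally have I: "(LINT x|truncated_measure k \<alpha>. Ln (1 - \<i> * of_real t * of_real x / w))
     = (CLINT x|\<alpha>. Ln (w - \<i> * of_real (t * clamp_real k x))) - of_real a * Ln w" .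
  have "exp (- (LINT x|truncated_measure k \<alpha>. Ln (1 - \<i> * of_real t * of_real x / w))) / w powr
        of_real a
     = exp (- (CLINT x|\<alpha>. Ln (w - \<i> * of_real (t * clamp_real k x))))"
    unfolding I using w by (auto simp: powr_def exp_diff exp_minus field_simps)
  \<comment> \<open>adding \<open>k\<close> makes the function nonnegative; the shift \<open>\<i> * t *
        k\<close> leaves the real part of \<open>w\<close> unchanged\<close>
  also have "\<dots> = exp (- (CLINT x|\<alpha>. Ln ((w + \<i> * of_real (t * k)) + (- \<i> * of_real t) *
        of_real (clamp_real k x + real k))))"
    by (simp add: algebra_simps)
  also have "\<dots> = (CLINT \<phi>|D. ((w + \<i> * of_real (t * k)) + (- \<i> * of_real t) * of_real
        (LINT x|\<phi>. clamp_real k x + real k)) powr (- of_real a))"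
  proof (rule markov_krein_bounded[where M="2 * k", symmetric])
    show "0 \<le> clamp_real k x + real k" "clamp_real k x + real k \<le> real (2 * k)" for x
      using clamp_real_bounds(1,2)[of k x] by auto
  qed (use w in auto)
  also have "\<dots> = (CLINT \<phi>|D. (w - \<i> * of_real (t * (LINT x|\<phi>. clamp_real k x))) powr (-
        of_real a))"
  proof (intro Bochner_Integration.integral_cong refl)
    fix \<phi> assume \<phi>: "\<phi> \<in> space D"
    interpret \<phi>: prob_space \<phi> using in_space_dirichlet_process[OF \<phi>] by simp
    have [measurable_cong]: "sets \<phi> = sets borel" using in_space_dirichlet_process[OF \<phi>] by simp
    have "integrable \<phi> (clamp_real k)"
      using clamp_real_bounds[of k] by (intro \<phi>.integrable_const_bound[of _ "real k"])
            (auto simp: abs_le_iff minus_le_iff)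
    then have "(LINT x|\<phi>. clamp_real k x + real k) = (LINT x|\<phi>. clamp_real k x) + real k"
      by (simp add: \<phi>.prob_space)
    then show "((w + \<i> * of_real (t * k)) + (- \<i> * of_real t) * of_real (LINT x|\<phi>. clamp_real k
          x + real k)) powr (- of_real a)
       = (w - \<i> * of_real (t * (LINT x|\<phi>. clamp_real k x))) powr (- of_real a)"
      by (simp add: algebra_simps)
  qed
  finally show ?thesis .
qed

text \<open>The integrand on the line is the expectation of \<open>shifted_exp_power\<close> with random shift $s = t m_k$.
On a bounded segment Fubini exchanges integral and expectation; the bound on the partial integrals,
uniform in the shift, lets the limit in $R$ pass under the expectation.\<close>

lemma pv_vertical_integral_truncated:
  assumes k: "1 \<le> k" and \<gamma>: "0 < \<gamma>"
  shows "has_pv_vertical_integral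
       (\<lambda>w. exp w / w powr complex_of_real a *
            exp (- (LINT x|truncated_measure k \<alpha>. Ln (1 - \<i> * complex_of_real t * complex_of_real
                  x / w))))
       (2 * pi * \<i> / of_real (Gamma a) * (CLINT \<phi>|D. exp (\<i> * of_real (t * (LINT x|\<phi>.
             clamp_real k x))))) \<gamma>"
    (is "has_pv_vertical_integral ?F _ _")
proof -
  interpret D: prob_space D by (rule prob_space_dirichlet_process)
  interpret P: pair_sigma_finite lborel D ..
  define m where "m = (\<lambda>\<phi>. t * (LINT x|\<phi>. clamp_real k x))"
  have m_m[measurable]: "m \<in> borel_measurable D"
    unfolding m_def using measurable_integral_prob_algebra(1)[OF clamp_real_measurable
          sets_dirichlet_process, of k] by simp
  have F_eq: "?F (Complex \<gamma> y) = (CLINT \<phi>|D. shifted_exp_power \<gamma> a (m \<phi>) y)" for y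
  proof -
    have "?F (Complex \<gamma> y) = exp (Complex \<gamma> y) * (CLINT \<phi>|D. (Complex \<gamma> y - \<i>
          * of_real (m \<phi>)) powr (- of_real a))"
      unfolding m_def using \<gamma> by (subst markov_krein_truncated[OF k, symmetric]) simp_all
    also have "\<dots> = (CLINT \<phi>|D. exp (Complex \<gamma> y) * (Complex \<gamma> y - \<i> * of_real
          (m \<phi>)) powr (- of_real a))"
      by simp
    also have "\<dots> = (CLINT \<phi>|D. shifted_exp_power \<gamma> a (m \<phi>) y)"
      by (intro Bochner_Integration.integral_cong) (auto simp: shifted_exp_power_def Complex_eq algebra_simps)
    finally show ?thesis .
  qed
  have bound: "cmod (shifted_exp_power \<gamma> a s y) \<le> exp \<gamma> * \<gamma> powr (- a)" for s y
    unfolding shifted_exp_power_def norm_mult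
    using norm_powr_minus_le[OF \<gamma> _ a, of "of_real \<gamma> + \<i> * of_real (y - s)"]
    by (intro mult_mono) auto
  have joint[measurable]: "(\<lambda>(y, \<phi>). shifted_exp_power \<gamma> a (m \<phi>) y) \<in>
        borel_measurable (lborel \<Otimes>\<^sub>M D)"
    unfolding shifted_exp_power_def by measurable
  define J where "J = (\<lambda>R. CLINT y|lborel. indicator {-R..R} y *\<^sub>R (CLINT \<phi>|D.
        shifted_exp_power \<gamma> a (m \<phi>) y))"
  have int2: "integrable (lborel \<Otimes>\<^sub>M D) (\<lambda>(y, \<phi>). indicator {-R..R} y *\<^sub>R
        shifted_exp_power \<gamma> a (m \<phi>) y)" for R
  proof (rule integrableI_bounded_set[where A="{-R..R} \<times> space D"
        and B="exp \<gamma> * \<gamma> powr (- a)"])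
    show "emeasure (lborel \<Otimes>\<^sub>M D) ({-R..R} \<times> space D) < \<infinity>"
      by (simp add: D.emeasure_pair_measure_Times D.emeasure_space_1 emeasure_lborel_Icc_eq)
    show "(\<lambda>(y, \<phi>). indicator {-R..R} y *\<^sub>R shifted_exp_power \<gamma> a (m \<phi>) y)
          \<in> borel_measurable (lborel \<Otimes>\<^sub>M D)"
      using joint by measurable
    show "AE z in lborel \<Otimes>\<^sub>M D. z \<notin> {-R..R} \<times> space D \<longrightarrow>
        (case z of (y, \<phi>) \<Rightarrow> indicator {-R..R} y *\<^sub>R shifted_exp_power \<gamma> a (m
              \<phi>) y) = 0"
      by (intro AE_I2) (auto simp: space_pair_measure indicator_def)
  qed (use bound in \<open>auto simp: indicator_def\<close>)
  have int1: "integrable lborel (\<lambda>y. indicator {-R..R} y *\<^sub>R (CLINT \<phi>|D.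
        shifted_exp_power \<gamma> a (m \<phi>) y))" for R
    using P.integrable_fst'[OF int2[of R]] by simp
  have J_swap: "J R = (CLINT \<phi>|D. CLINT y|lborel. indicator {-R..R} y *\<^sub>R shifted_exp_power
        \<gamma> a (m \<phi>) y)" for R
    unfolding J_def using P.Fubini_integral[OF int2[of R]] by simp
  have contour: "(?F has_contour_integral (\<i> * J R)) (linepath (Complex \<gamma> (- R)) (Complex
        \<gamma> R))" if "0 < R" for R
  proof -
    have "((\<lambda>y. indicator {-R..R} y *\<^sub>R (CLINT \<phi>|D. shifted_exp_power \<gamma> a (m
          \<phi>) y)) has_integral J R) UNIV"
      unfolding J_def by (rule has_integral_integral_lborel[OF int1])
    also have "(\<lambda>y. indicator {-R..R} y *\<^sub>R (CLINT \<phi>|D. shifted_exp_power \<gamma> a (m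
          \<phi>) y)) = (\<lambda>y. if y \<in> {-R..R} then ?F (Complex \<gamma> y) else 0)"
      unfolding F_eq by (auto simp: indicator_def)
    finally have "((\<lambda>y. ?F (Complex \<gamma> y)) has_integral J R) {-R..R}"
      unfolding has_integral_restrict_UNIV .
    then show ?thesis
      using that by (subst has_contour_integral_linepath_same_Re_iff[where c=\<gamma> and a="- R" and b=R]) auto
  qed
  obtain C where C: "\<And>R s. 0 \<le> R
        \<Longrightarrow> cmod (CLINT y|lborel. indicator {-R..R} y *\<^sub>R shifted_exp_power \<gamma> a
        s y) \<le> C"
    using truncated_inversion_bounded[OF \<gamma> a] by blast
  have "((\<lambda>R. CLINT \<phi>|D. CLINT y|lborel. indicator {-R..R} y *\<^sub>R shifted_exp_power
        \<gamma> a (m \<phi>) y)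
      \<longlongrightarrow> (CLINT \<phi>|D. 2 * pi * iexp (m \<phi>) / of_real (Gamma a))) at_top"
  proof (rule integral_dominated_convergence_at_top[where w="\<lambda>_. C"])
    show "\<forall>\<^sub>F R in at_top. AE \<phi> in D. norm (CLINT y|lborel. indicator {-R..R} y
          *\<^sub>R shifted_exp_power \<gamma> a (m \<phi>) y) \<le> C"
      using eventually_ge_at_top[of 0] by eventually_elim (auto intro: C)
    show "AE \<phi> in D. ((\<lambda>R. CLINT y|lborel. indicator {-R..R} y *\<^sub>R shifted_exp_power
          \<gamma> a (m \<phi>) y)
        \<longlongrightarrow> 2 * pi * iexp (m \<phi>) / of_real (Gamma a)) at_top"
      using truncated_inversion_tendsto[OF \<gamma> a] by (intro AE_I2) auto
    show "(\<lambda>\<phi>. CLINT y|lborel. indicator {-R..R} y *\<^sub>R shifted_exp_power \<gamma> a (m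
          \<phi>) y) \<in> borel_measurable D" for R
      using borel_measurable_integrable[OF P.integrable_snd[OF int2[of R]]] .
  qed auto
  then have "((\<lambda>R. \<i> * J R) \<longlongrightarrow> \<i> * (CLINT \<phi>|D. 2 * pi * iexp (m
        \<phi>) / of_real (Gamma a))) at_top"
    unfolding J_swap by (intro tendsto_intros)
  moreover have "\<forall>\<^sub>F R in at_top. \<i> * J R
        = contour_integral (linepath (Complex \<gamma> (- R)) (Complex \<gamma> R)) ?F"
    using eventually_gt_at_top[of 0] by eventually_elim (rule contour_integral_unique[OF contour, symmetric])
  ultimately have lim: "((\<lambda>R. contour_integral (linepath (Complex \<gamma> (- R)) (Complex \<gamma>
        R)) ?F)
      \<longlongrightarrow> \<i> * (CLINT \<phi>|D. 2 * pi * iexp (m \<phi>) / of_real (Gamma a))) at_top"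
    by (rule Lim_transform_eventually)
  have value_eq: "\<i> * (CLINT \<phi>|D. 2 * pi * iexp (m \<phi>) / of_real (Gamma a))
      = 2 * pi * \<i> / of_real (Gamma a) * (CLINT \<phi>|D. iexp (m \<phi>))"
    by simp
  show ?thesis
    unfolding has_pv_vertical_integral_def
  proof (intro conjI allI impI)
    show "?F contour_integrable_on linepath (Complex \<gamma> (- R)) (Complex \<gamma> R)" if "0 < R" for R
      using contour[OF that] unfolding contour_integrable_on_def by blast
    show "((\<lambda>R. contour_integral (linepath (Complex \<gamma> (- R)) (Complex \<gamma> R)) ?F)
      \<longlongrightarrow> 2 * pi * \<i> / of_real (Gamma a) * (CLINT \<phi>|D. exp (\<i> * of_real (t *
            (LINT x|\<phi>. clamp_real k x))))) at_top"
      using lim unfolding value_eq unfolding m_def .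
  qed
qed

end

theorem theorem7:
  fixes a t \<gamma> :: real and \<alpha> :: "real measure" and D :: "real measure measure"
  assumes "a > 0"
    and "\<alpha> \<in> log_finite_measures a"
    and "dirichlet_process_law \<alpha> D"
    and "\<gamma> > 0"
  shows "\<exists>PV :: nat \<Rightarrow> complex.
    (\<forall>k\<ge>1. has_pv_vertical_integral
       (\<lambda>w. exp w / w powr complex_of_real a *
            exp (- (LINT x|truncated_measure k \<alpha>.
                      Ln (1 - \<i> * complex_of_real t * complex_of_real x / w))))
       (PV k) \<gamma>) \<and>
    (\<lambda>k. complex_of_real (Gamma a) / (2 * complex_of_real pi * \<i>) * PV k)
      \<longlonglongrightarrow> (LINT \<phi>|D. exp (\<i> * complex_of_real (t * (LINT x|\<phi>. x))))"
proof -
  have sets_\<alpha>: "sets \<alpha> = sets borel" and mass: "emeasure \<alpha> UNIV = ennreal a"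
    and log: "integrable \<alpha> (\<lambda>x. ln (1 + \<bar>x\<bar>))"
    using assms(2) by (auto simp: log_finite_measures_def)
  note law = assms(3)
  interpret D: prob_space D by (rule prob_space_dirichlet_process[OF assms(1) sets_\<alpha> mass law])
  define E where "E = (\<lambda>k. CLINT \<phi>|D. exp (\<i> * of_real (t * (LINT x|\<phi>. clamp_real k x))))"
  have lim: "E \<longlonglongrightarrow> (CLINT \<phi>|D. exp (\<i> * of_real (t * (LINT x|\<phi>. x))))"
    unfolding E_def
  proof (rule integral_dominated_convergence[where w="\<lambda>_. 1"])
    have [measurable]: "(\<lambda>\<phi>. LINT x|\<phi>. clamp_real k x) \<in> borel_measurable D" for k
      by (intro measurable_integral_prob_algebra(1)[OF _ sets_dirichlet_process[OF assms(1) sets_\<alpha>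
            mass law]]) simp
    have [measurable]: "(\<lambda>\<phi>. LINT x|\<phi>. x) \<in> borel_measurable D"
      by (intro measurable_integral_prob_algebra(1)[OF _ sets_dirichlet_process[OF assms(1) sets_\<alpha>
            mass law]]) simp
    show "(\<lambda>\<phi>. exp (\<i> * of_real (t * (LINT x|\<phi>. x)))) \<in> borel_measurable D" by
          measurable
    show "(\<lambda>\<phi>. exp (\<i> * of_real (t * (LINT x|\<phi>. clamp_real k x)))) \<in>
          borel_measurable D" for k by measurable
    show "AE \<phi> in D. (\<lambda>k. exp (\<i> * of_real (t * (LINT x|\<phi>. clamp_real k x))))
          \<longlonglongrightarrow> exp (\<i> * of_real (t * (LINT x|\<phi>. x)))"
      using integrable_under_dirichlet_process[OF assms(1) sets_\<alpha> mass law log] AE_space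
    proof eventually_elim
      case (elim \<phi>)
      have [measurable_cong]: "sets \<phi> = sets borel"
            using in_space_dirichlet_process[OF assms(1) sets_\<alpha> mass law elim(2)] by simp
      have "(\<lambda>k. LINT x|\<phi>. clamp_real k x) \<longlonglongrightarrow> (LINT x|\<phi>. x)"
      proof (rule integral_dominated_convergence[where w="\<lambda>x. \<bar>x\<bar>"])
        show "integrable \<phi> (\<lambda>x. \<bar>x\<bar>)" using elim(1) by (rule integrable_abs)
        show "AE x in \<phi>. (\<lambda>k. clamp_real k x) \<longlonglongrightarrow> x"
              by (intro AE_I2 clamp_real_tendsto)
        show "AE x in \<phi>. norm (clamp_real k x) \<le> \<bar>x\<bar>" for k
          by (intro AE_I2) (simp only: real_norm_def clamp_real_bounds)
      qed measurable
      then show ?case by (intro tendsto_intros)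
    qed
  qed auto
  have eq: "complex_of_real (Gamma a) / (2 * complex_of_real pi * \<i>) * (2 * pi * \<i> / of_real (Gamma
        a) * E k) = E k" for k
    using Gamma_real_pos[OF assms(1)] by (simp add: field_simps)
  have pv: "has_pv_vertical_integral
       (\<lambda>w. exp w / w powr complex_of_real a *
            exp (- (LINT x|truncated_measure k \<alpha>. Ln (1 - \<i> * complex_of_real t * complex_of_real
                  x / w))))
       (2 * pi * \<i> / of_real (Gamma a) * E k) \<gamma>" if "1 \<le> k" for k
    unfolding E_def by (rule pv_vertical_integral_truncated[OF assms(1) sets_\<alpha> mass law that assms(4)])
  show ?thesis
  proof (intro exI[of _ "\<lambda>k. 2 * pi * \<i> / of_real (Gamma a) * E k"] conjI allI impI)
    show "(\<lambda>k. complex_of_real (Gamma a) / (2 * complex_of_real pi * \<i>) * (2 * pi * \<i> /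
          of_real (Gamma a) * E k))
      \<longlonglongrightarrow> (LINT \<phi>|D. exp (\<i> * complex_of_real (t * (LINT x|\<phi>. x))))"
      unfolding eq by (rule lim)
  qed (rule pv)
qed

end
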